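(* Let $p\neq 3$ be a prime with $p\equiv 3\pmod 4$. Let $D\in GF(p)$ be a non-square, let $\sigma$ be a primitive root (generator of the multiplicative group) of $GF(p^{2})=GF(p)(\sqrt{D})$, and let $m,n\in GF(p)$ be given by $m+n\sqrt{D}=\sigma^{\frac{p^{2}-1}{4}}$; assume $n\neq 0$. Let $G=\langle a,b,c\mid a^{4}=b^{p}=c^{p}=[b,c]=1,\ a^{-1}ba=b^{m}c^{nD},\ a^{-1}ca=b^{n}c^{m}\rangle$. Then $\mathrm{Aut}(G)\simeq(\mathbb{Z}_{p}\times\mathbb{Z}_{p})\rtimes(\mathbb{Z}_{p^{2}-1}\rtimes\mathbb{Z}_{2})$.
   Context: $\mathbb{Z}_n$ is the cyclic group of order $n$; $GF(p^k)$ is the field with $p^k$ elements; $[x,y]=x^{-1}y^{-1}xy$. Exponents of $b,c$ lying in $GF(p)$ are interpreted via integer representatives. (This is a group of order $p^2q^2$ with $q=2$ and $pq\neq 6$.) $X\rtimes Y$ denotes a semidirect product with normal subgroup $X$ with respect to some homomorphism $Y\to\mathrm{Aut}(X)$; the statement asserts that $\mathrm{Aut}(G)$ is isomorphic to such an (iterated) semidirect product for some choice of actions. *)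

theory Defs
  imports "HOL-Algebra.Algebra" "HOL-Number_Theory.Number_Theory"
begin

section \<open>Groups given by generators and relations\<close>

text \<open>
  A word over the generators in \<^typ>\<open>'g\<close> is a list of letters; \<open>(x, True)\<close> stands for \<open>x\<close>
  and \<open>(x, False)\<close> for its inverse. A relation \<open>u = v\<close> is the pair of words \<open>(u, v)\<close>.
\<close>

type_synonym 'g word = "('g \<times> bool) list"

definition gen_pow :: "'g \<Rightarrow> int \<Rightarrow> 'g word" where
  "gen_pow x k = replicate (nat \<bar>k\<bar>) (x, 0 \<le> k)"

inductive_set word_cong :: "('g word \<times> 'g word) set \<Rightarrow> ('g word \<times> 'g word) set"
  for R :: "('g word \<times> 'g word) set" where
  rel: "(u, v) \<in> R \<Longrightarrow> (u, v) \<in> word_cong R"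
| cancel: "([(x, e), (x, \<not> e)], []) \<in> word_cong R"
| refl: "(u, u) \<in> word_cong R"
| sym: "(u, v) \<in> word_cong R \<Longrightarrow> (v, u) \<in> word_cong R"
| trans: "(u, v) \<in> word_cong R \<Longrightarrow> (v, w) \<in> word_cong R \<Longrightarrow> (u, w) \<in> word_cong R"
| app: "(u, v) \<in> word_cong R \<Longrightarrow> (u', v') \<in> word_cong R \<Longrightarrow> (u @ u', v @ v') \<in> word_cong R"

definition presented_group :: "('g word \<times> 'g word) set \<Rightarrow> 'g word set monoid" where
  "presented_group R =
    \<lparr>carrier = UNIV // word_cong R,
     monoid.mult = (\<lambda>U V. \<Union>u\<in>U. \<Union>v\<in>V. word_cong R `` {u @ v}),
     one = word_cong R `` {[]}\<rparr>"

lemma equiv_word_cong: "equiv UNIV (word_cong R)"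
  by (rule equivI) (auto intro: refl_onI symI transI word_cong.intros)

lemma presented_group_mult:
  "word_cong R `` {u} \<otimes>\<^bsub>presented_group R\<^esub> word_cong R `` {v} = word_cong R `` {u @ v}"
proof -
  have "congruent2 (word_cong R) (word_cong R) (\<lambda>u v. word_cong R `` {u @ v})"
    by (rule congruent2I') (meson equiv_class_eq equiv_word_cong word_cong.app)
  from UN_equiv_class2[OF equiv_word_cong equiv_word_cong this] show ?thesis
    by (simp add: presented_group_def)
qed

lemma word_cong_inverse: "(map (\<lambda>(x, e). (x, \<not> e)) (rev w) @ w, []) \<in> word_cong R"
proof (induction w)
  case Nil
  show ?case by (simp add: word_cong.refl)
next
  case (Cons l w)
  obtain x e where l: "l = (x, e)" by force
  let ?i = "map (\<lambda>(x, e). (x, \<not> e)) (rev w)"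
  have "([(x, \<not> e), (x, e)] @ w, [] @ w) \<in> word_cong R"
    using word_cong.app[OF word_cong.cancel[of x "\<not> e"] word_cong.refl[of w]] by simp
  then have "(?i @ [(x, \<not> e), (x, e)] @ w, ?i @ [] @ w) \<in> word_cong R"
    by (rule word_cong.app[OF word_cong.refl])
  with Cons.IH show ?case
    by (auto simp: l intro: word_cong.trans)
qed

lemma group_presented_group: "group (presented_group R)"
proof (rule groupI)
  fix U V W
  assume "U \<in> carrier (presented_group R)" "V \<in> carrier (presented_group R)"
    "W \<in> carrier (presented_group R)"
  then obtain u v w where "U = word_cong R `` {u}" "V = word_cong R `` {v}" "W = word_cong R `` {w}"
    by (auto simp: presented_group_def elim!: quotientE)
  then show "U \<otimes>\<^bsub>presented_group R\<^esub> V \<otimes>\<^bsub>presented_group R\<^esub> W =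
      U \<otimes>\<^bsub>presented_group R\<^esub> (V \<otimes>\<^bsub>presented_group R\<^esub> W)"
    by (simp add: presented_group_mult)
next
  fix U V
  assume "U \<in> carrier (presented_group R)" "V \<in> carrier (presented_group R)"
  then obtain u v where "U = word_cong R `` {u}" "V = word_cong R `` {v}"
    by (auto simp: presented_group_def elim!: quotientE)
  then show "U \<otimes>\<^bsub>presented_group R\<^esub> V \<in> carrier (presented_group R)"
    by (simp add: presented_group_mult) (simp add: presented_group_def quotientI)
next
  show "\<one>\<^bsub>presented_group R\<^esub> \<in> carrier (presented_group R)"
    by (simp add: presented_group_def quotientI)
next
  fix U
  assume "U \<in> carrier (presented_group R)"
  then obtain u where U: "U = word_cong R `` {u}"
    by (auto simp: presented_group_def elim!: quotientE)
  have one: "\<one>\<^bsub>presented_group R\<^esub> = word_cong R `` {[]}"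
    by (simp add: presented_group_def)
  show "\<one>\<^bsub>presented_group R\<^esub> \<otimes>\<^bsub>presented_group R\<^esub> U = U"
    by (simp add: U one presented_group_mult)
  let ?i = "word_cong R `` {map (\<lambda>(x, e). (x, \<not> e)) (rev u)}"
  have "?i \<otimes>\<^bsub>presented_group R\<^esub> U = \<one>\<^bsub>presented_group R\<^esub>"
    unfolding U one presented_group_mult
    by (rule equiv_class_eq[OF equiv_word_cong word_cong_inverse])
  moreover have "?i \<in> carrier (presented_group R)"
    by (simp add: presented_group_def quotientI)
  ultimately show "\<exists>V\<in>carrier (presented_group R). V \<otimes>\<^bsub>presented_group R\<^esub> U = \<one>\<^bsub>presented_group R\<^esub>"
    by blast
qed

datatype abc = a | b | c

definition G_rels :: "nat \<Rightarrow> int \<Rightarrow> int \<Rightarrow> int \<Rightarrow> (abc word \<times> abc word) set" where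
  "G_rels p D m n =
    {(gen_pow a 4, []),
     (gen_pow b (int p), []),
     (gen_pow c (int p), []),
     (gen_pow b (-1) @ gen_pow c (-1) @ gen_pow b 1 @ gen_pow c 1, []),
     (gen_pow a (-1) @ gen_pow b 1 @ gen_pow a 1, gen_pow b m @ gen_pow c (n * D)),
     (gen_pow a (-1) @ gen_pow c 1 @ gen_pow a 1, gen_pow b n @ gen_pow c m)}"

hide_const (open) a b c


section \<open>Semidirect products\<close>

definition semidirect ::
    "('n, 'e) monoid_scheme \<Rightarrow> ('h, 'f) monoid_scheme \<Rightarrow> ('h \<Rightarrow> 'n \<Rightarrow> 'n) \<Rightarrow> ('n \<times> 'h) monoid" where
  "semidirect N H \<phi> =
    \<lparr>carrier = carrier N \<times> carrier H,
     monoid.mult = (\<lambda>(x, y) (x', y'). (x \<otimes>\<^bsub>N\<^esub> \<phi> y x', y \<otimes>\<^bsub>H\<^esub> y')),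
     one = (\<one>\<^bsub>N\<^esub>, \<one>\<^bsub>H\<^esub>)\<rparr>"

text \<open>Multiplication in \<^const>\<open>AutoGroup\<close> is composition, so an element of \<open>hom H (AutoGroup N)\<close> is a left action.\<close>

lemma group_semidirect:
  assumes "group N" "group H" and \<phi>: "\<phi> \<in> hom H (AutoGroup N)"
  shows "group (semidirect N H \<phi>)"
proof -
  interpret N: group N by fact
  interpret H: group H by fact
  interpret hm: group_hom H "AutoGroup N" \<phi>
    by (simp add: group_hom_def group_hom_axioms_def assms N.AutoGroup)
  have aut: "\<phi> y \<in> hom N N" "\<phi> y \<in> Bij (carrier N)" if "y \<in> carrier H" for y
    using hm.hom_closed[OF that] by (auto simp: AutoGroup_def auto_def)
  have cl: "\<phi> y x \<in> carrier N" if "y \<in> carrier H" "x \<in> carrier N" for x y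
    using aut(1)[OF that(1)] that(2) by (auto simp: hom_def)
  have mult: "\<phi> y (x \<otimes>\<^bsub>N\<^esub> x') = \<phi> y x \<otimes>\<^bsub>N\<^esub> \<phi> y x'"
    if "y \<in> carrier H" "x \<in> carrier N" "x' \<in> carrier N" for x x' y
    using aut(1)[OF that(1)] that by (auto simp: hom_def)
  have comp: "\<phi> (y \<otimes>\<^bsub>H\<^esub> y') x = \<phi> y (\<phi> y' x)"
    if "y \<in> carrier H" "y' \<in> carrier H" "x \<in> carrier N" for x y y'
    using hm.hom_mult[OF that(1,2)] aut(2)[OF that(1)] aut(2)[OF that(2)] that(3)
    by (simp add: AutoGroup_def BijGroup_def compose_def)
  have one: "\<phi> \<one>\<^bsub>H\<^esub> x = x" if "x \<in> carrier N" for x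
    using hm.hom_one that by (simp add: AutoGroup_def BijGroup_def)
  show ?thesis
  proof (rule groupI)
    fix z assume "z \<in> carrier (semidirect N H \<phi>)"
    then obtain x y where z: "z = (x, y)" "x \<in> carrier N" "y \<in> carrier H"
      by (auto simp: semidirect_def)
    let ?i = "(\<phi> (inv\<^bsub>H\<^esub> y) (inv\<^bsub>N\<^esub> x), inv\<^bsub>H\<^esub> y)"
    have "\<phi> (inv\<^bsub>H\<^esub> y) \<one>\<^bsub>N\<^esub> = \<one>\<^bsub>N\<^esub>"
      using hom_one[OF aut(1)[of "inv\<^bsub>H\<^esub> y"]] z assms(1) by simp
    then have "\<phi> (inv\<^bsub>H\<^esub> y) (inv\<^bsub>N\<^esub> x) \<otimes>\<^bsub>N\<^esub> \<phi> (inv\<^bsub>H\<^esub> y) x = \<one>\<^bsub>N\<^esub>"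
      using mult[of "inv\<^bsub>H\<^esub> y" "inv\<^bsub>N\<^esub> x" x] z by (simp del: hm.hom_inv)
    then have "?i \<otimes>\<^bsub>semidirect N H \<phi>\<^esub> z = \<one>\<^bsub>semidirect N H \<phi>\<^esub>"
      using z by (simp add: semidirect_def del: hm.hom_inv)
    moreover have "?i \<in> carrier (semidirect N H \<phi>)"
      using z by (simp add: semidirect_def cl del: hm.hom_inv)
    ultimately show "\<exists>w\<in>carrier (semidirect N H \<phi>). w \<otimes>\<^bsub>semidirect N H \<phi>\<^esub> z = \<one>\<^bsub>semidirect N H \<phi>\<^esub>"
      by blast
  qed (auto simp: semidirect_def cl mult comp one N.m_assoc H.m_assoc simp del: hm.hom_mult hm.hom_one)
qed

end

theory Submission
  imports Defs
begin

text \<open>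
  Write \<open>G\<close> for the presented group and identify \<open>b^x c^y\<close> with the element \<open>y + x sqrt D\<close>
  of \<open>K\<close>. The relations then say that \<open>a\<^sup>-\<^sup>1\<close> acts on \<open>\<langle>b, c\<rangle>\<close> as multiplication by
  \<open>\<iota> = m + n sqrt D\<close>, an element of order \<open>4\<close> of the multiplicative group. Hence \<open>G\<close> is the group of
  affine permutations \<open>z \<mapsto> r z + v\<close> of \<open>K\<close> with \<open>r ^ 4 = 1\<close>: a normal form gives injectivity of
  the representation (\<open>rep_inj\<close>), and its image is computed in \<open>rep_image\<close>.

  Inside the symmetric group of \<open>K\<close>, this group is normalised by all semilinear affine permutations
  \<open>z \<mapsto> u \<tau>(z) + v\<close> with \<open>u \<noteq> 0\<close> and \<open>\<tau>\<close> a field automorphism over the prime field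
  (\<open>rep_normalised\<close>), because \<open>\<tau>\<close> permutes the fourth roots of unity. Conjugation is an isomorphism
  from the group of these permutations to the automorphism group of \<open>G\<close>. It is injective since only
  the identity commutes with the images of \<open>a\<close>, \<open>b\<close>, \<open>c\<close> (\<open>conjugation_faithful\<close>). It is surjective
  (\<open>automorphism_is_conjugation\<close>) because an automorphism must send \<open>b\<close> and \<open>c\<close>, elements of
  order \<open>p\<close>, to translations by some \<open>\<beta>\<close> and \<open>\<gamma>\<close>, and the two conjugation relations, applied
  to the images, leave only \<open>\<beta> = \<plusminus> (sqrt D) \<gamma>\<close>. The sign is the choice of \<open>\<tau>\<close>, the factor is
  \<open>u = \<gamma>\<close>, and the image of \<open>a\<close> determines \<open>v\<close>.

  The group of semilinear affine permutations is built from translations, scalings and field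
  automorphisms. Scalings are normalised by field automorphisms, and translations by both, so it is
  an iterated semidirect product of \<open>\<int>\<^sub>p \<times> \<int>\<^sub>p\<close>, \<open>\<int>\<^sub>q\<close> with \<open>q = p^2 - 1\<close>, and
  \<open>\<int>\<^sub>2\<close> (\<open>semilinear_affine_group\<close>). The two actions and the isomorphism onto the automorphism group
  are all instances of one construction, \<open>conjugation_action\<close>.
\<close>

section \<open>Conjugation actions and semidirect products\<close>

text \<open>
  Conjugation in \<open>S\<close> by an element of \<open>g(H)\<close> preserves \<open>f(N)\<close>, and injectivity of \<open>f\<close> transports it
  back to an automorphism of \<open>N\<close>. Writing \<open>g y \<otimes> f x = f x' \<otimes> g y\<close> instead of a conjugate keeps
  inverses out of every use of the lemma.
\<close>

lemma conjugation_action: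
  assumes "group N" "group H" "group S"
    and f: "f \<in> hom N S" "inj_on f (carrier N)" and g: "g \<in> hom H S"
    and normal: "\<And>x y. \<lbrakk>x \<in> carrier N; y \<in> carrier H\<rbrakk> \<Longrightarrow>
      \<exists>x'\<in>carrier N. g y \<otimes>\<^bsub>S\<^esub> f x = f x' \<otimes>\<^bsub>S\<^esub> g y"
  obtains \<phi> where "\<phi> \<in> hom H (AutoGroup N)"
    and "\<And>x y. \<lbrakk>x \<in> carrier N; y \<in> carrier H\<rbrakk> \<Longrightarrow> g y \<otimes>\<^bsub>S\<^esub> f x = f (\<phi> y x) \<otimes>\<^bsub>S\<^esub> g y"
proof -
  interpret N: group N by fact
  interpret H: group H by fact
  interpret S: group S by fact
  interpret f: group_hom N S f
    by (simp add: group_hom_def group_hom_axioms_def assms)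
  interpret g: group_hom H S g
    by (simp add: group_hom_def group_hom_axioms_def assms)
  define \<phi> where "\<phi> y = (\<lambda>x\<in>carrier N. SOME x'. x' \<in> carrier N \<and> g y \<otimes>\<^bsub>S\<^esub> f x = f x' \<otimes>\<^bsub>S\<^esub> g y)" for y
  have \<phi>: "\<phi> y x \<in> carrier N \<and> g y \<otimes>\<^bsub>S\<^esub> f x = f (\<phi> y x) \<otimes>\<^bsub>S\<^esub> g y"
    if "x \<in> carrier N" "y \<in> carrier H" for x y
    using someI_ex[OF normal[OF that, unfolded Bex_def]] that by (simp add: \<phi>_def)
  have uniq: "\<phi> y x = x'"
    if "x \<in> carrier N" "y \<in> carrier H" "x' \<in> carrier N" "g y \<otimes>\<^bsub>S\<^esub> f x = f x' \<otimes>\<^bsub>S\<^esub> g y" for x y x'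
  proof -
    have "f (\<phi> y x) = f x'"
      using \<phi>[OF that(1,2)] that(4) f.hom_closed[of "\<phi> y x"] f.hom_closed[OF that(3)] g.hom_closed[OF that(2)]
      by (metis S.right_cancel)
    with f(2) \<phi>[OF that(1,2)] that(3) show ?thesis
      by (auto dest: inj_onD)
  qed
  have mult: "\<phi> y (x \<otimes>\<^bsub>N\<^esub> x') = \<phi> y x \<otimes>\<^bsub>N\<^esub> \<phi> y x'"
    if "x \<in> carrier N" "x' \<in> carrier N" "y \<in> carrier H" for x x' y
  proof (rule uniq)
    have "g y \<otimes>\<^bsub>S\<^esub> f (x \<otimes>\<^bsub>N\<^esub> x') = (g y \<otimes>\<^bsub>S\<^esub> f x) \<otimes>\<^bsub>S\<^esub> f x'"
      using that by (simp add: S.m_assoc)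
    also have "\<dots> = f (\<phi> y x) \<otimes>\<^bsub>S\<^esub> (g y \<otimes>\<^bsub>S\<^esub> f x')"
      using \<phi>[OF that(1,3)] that by (simp add: S.m_assoc)
    also have "\<dots> = f (\<phi> y x \<otimes>\<^bsub>N\<^esub> \<phi> y x') \<otimes>\<^bsub>S\<^esub> g y"
      using \<phi>[OF that(1,3)] \<phi>[OF that(2,3)] that by (simp add: S.m_assoc)
    finally show "g y \<otimes>\<^bsub>S\<^esub> f (x \<otimes>\<^bsub>N\<^esub> x') = f (\<phi> y x \<otimes>\<^bsub>N\<^esub> \<phi> y x') \<otimes>\<^bsub>S\<^esub> g y" .
  qed (use that \<phi> in auto)
  have comp: "\<phi> (y \<otimes>\<^bsub>H\<^esub> y') x = \<phi> y (\<phi> y' x)"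
    if "x \<in> carrier N" "y \<in> carrier H" "y' \<in> carrier H" for x y y'
  proof (rule uniq)
    have "g (y \<otimes>\<^bsub>H\<^esub> y') \<otimes>\<^bsub>S\<^esub> f x = g y \<otimes>\<^bsub>S\<^esub> (g y' \<otimes>\<^bsub>S\<^esub> f x)"
      using that by (simp add: S.m_assoc)
    also have "\<dots> = (g y \<otimes>\<^bsub>S\<^esub> f (\<phi> y' x)) \<otimes>\<^bsub>S\<^esub> g y'"
      using \<phi>[OF that(1,3)] that by (simp add: S.m_assoc)
    also have "\<dots> = f (\<phi> y (\<phi> y' x)) \<otimes>\<^bsub>S\<^esub> g (y \<otimes>\<^bsub>H\<^esub> y')"
      using \<phi>[OF that(1,3)] \<phi>[of "\<phi> y' x" y] that by (simp add: S.m_assoc)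
    finally show "g (y \<otimes>\<^bsub>H\<^esub> y') \<otimes>\<^bsub>S\<^esub> f x = f (\<phi> y (\<phi> y' x)) \<otimes>\<^bsub>S\<^esub> g (y \<otimes>\<^bsub>H\<^esub> y')" .
  qed (use that \<phi> in auto)
  have one: "\<phi> \<one>\<^bsub>H\<^esub> x = x" if "x \<in> carrier N" for x
    by (rule uniq) (use that in auto)
  have aut: "\<phi> y \<in> auto N" if y: "y \<in> carrier H" for y
  proof -
    have "bij_betw (\<phi> y) (carrier N) (carrier N)"
      by (rule bij_betw_byWitness[where f' = "\<phi> (inv\<^bsub>H\<^esub> y)"])
        (use y \<phi> one comp in \<open>auto simp flip: comp\<close>)
    then show ?thesis
      using y \<phi> mult by (auto simp: auto_def Bij_def hom_def) (simp add: \<phi>_def)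
  qed
  have "\<phi> \<in> hom H (AutoGroup N)"
  proof (rule homI)
    show "\<phi> y \<in> carrier (AutoGroup N)" if "y \<in> carrier H" for y
      using aut[OF that] by (simp add: AutoGroup_def)
    fix y y' assume y: "y \<in> carrier H" "y' \<in> carrier H"
    then have "\<phi> (y \<otimes>\<^bsub>H\<^esub> y') = compose (carrier N) (\<phi> y) (\<phi> y')"
      by (intro extensionalityI[where A = "carrier N"])
        (auto simp: comp compose_eq, simp add: \<phi>_def)
    then show "\<phi> (y \<otimes>\<^bsub>H\<^esub> y') = \<phi> y \<otimes>\<^bsub>AutoGroup N\<^esub> \<phi> y'"
      using aut y by (simp add: AutoGroup_def BijGroup_def auto_def)
  qed
  with \<phi> that show thesis
    by blast
qed

text \<open>
  The image is the product \<open>f(N) g(H)\<close>. With the action supplied by the preceding lemma, a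
  product of two subgroups, one normalised by the other, becomes an external semidirect product
  as soon as the map is injective.
\<close>

lemma semidirect_hom:
  assumes "group N" "group H" "group S"
    and f: "f \<in> hom N S" and g: "g \<in> hom H S" and \<phi>: "\<phi> \<in> hom H (AutoGroup N)"
    and conj: "\<And>x y. \<lbrakk>x \<in> carrier N; y \<in> carrier H\<rbrakk> \<Longrightarrow> g y \<otimes>\<^bsub>S\<^esub> f x = f (\<phi> y x) \<otimes>\<^bsub>S\<^esub> g y"
  shows "(\<lambda>(x, y). f x \<otimes>\<^bsub>S\<^esub> g y) \<in> hom (semidirect N H \<phi>) S"
proof -
  interpret N: group N by fact
  interpret S: group S by fact
  interpret f: group_hom N S f
    by (simp add: group_hom_def group_hom_axioms_def assms)
  interpret g: group_hom H S g
    by (simp add: group_hom_def group_hom_axioms_def assms)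
  have cl: "\<phi> y x \<in> carrier N" if "x \<in> carrier N" "y \<in> carrier H" for x y
    using hom_in_carrier[OF \<phi> that(2)] that(1) by (auto simp: AutoGroup_def auto_def hom_def)
  have "f (x \<otimes>\<^bsub>N\<^esub> \<phi> y x') \<otimes>\<^bsub>S\<^esub> g (y \<otimes>\<^bsub>H\<^esub> y') = (f x \<otimes>\<^bsub>S\<^esub> g y) \<otimes>\<^bsub>S\<^esub> (f x' \<otimes>\<^bsub>S\<^esub> g y')"
    if "x \<in> carrier N" "x' \<in> carrier N" "y \<in> carrier H" "y' \<in> carrier H" for x x' y y'
  proof -
    have "(f x \<otimes>\<^bsub>S\<^esub> g y) \<otimes>\<^bsub>S\<^esub> (f x' \<otimes>\<^bsub>S\<^esub> g y') = f x \<otimes>\<^bsub>S\<^esub> (g y \<otimes>\<^bsub>S\<^esub> f x') \<otimes>\<^bsub>S\<^esub> g y'"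
      using that by (simp add: S.m_assoc)
    also have "\<dots> = f (x \<otimes>\<^bsub>N\<^esub> \<phi> y x') \<otimes>\<^bsub>S\<^esub> g (y \<otimes>\<^bsub>H\<^esub> y')"
      using that by (simp add: conj cl S.m_assoc)
    finally show ?thesis by simp
  qed
  then show ?thesis
    by (intro homI) (auto simp: semidirect_def)
qed

lemma integer_mod_group_hom:
  assumes "group S" "x \<in> carrier S" "x [^]\<^bsub>S\<^esub> n = \<one>\<^bsub>S\<^esub>"
  shows "(\<lambda>j::int. x [^]\<^bsub>S\<^esub> j) \<in> hom (integer_mod_group n) S"
proof -
  interpret group S by fact
  have "x [^]\<^bsub>S\<^esub> (k mod int n) = x [^]\<^bsub>S\<^esub> k" for k
  proof -
    have "int (ord x) dvd int n"
      using assms pow_eq_id by auto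
    then have "int (ord x) dvd k - k mod int n"
      by (rule dvd_trans) simp
    then show ?thesis
      using assms(2) by (simp add: int_pow_eq)
  qed
  then show ?thesis
    using assms(2) by (intro homI) (auto simp: int_pow_mult)
qed

section \<open>Homomorphisms out of presented groups\<close>

definition word_value :: "('m, 'e) monoid_scheme \<Rightarrow> ('g \<Rightarrow> 'm) \<Rightarrow> 'g word \<Rightarrow> 'm" where
  "word_value S h w =
    foldr (\<lambda>(x, e) r. (if e then h x else inv\<^bsub>S\<^esub> h x) \<otimes>\<^bsub>S\<^esub> r) w \<one>\<^bsub>S\<^esub>"

context group
begin

lemma word_value_Nil [simp]: "word_value G h [] = \<one>"
  by (simp add: word_value_def)

lemma word_value_Cons [simp]:
  "word_value G h ((x, e) # w) = (if e then h x else inv h x) \<otimes> word_value G h w"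
  by (simp add: word_value_def)

lemma word_value_closed [simp]: "range h \<subseteq> carrier G \<Longrightarrow> word_value G h w \<in> carrier G"
  by (induction w) (auto simp: range_subsetD)

lemma word_value_append [simp]:
  "range h \<subseteq> carrier G \<Longrightarrow> word_value G h (v @ w) = word_value G h v \<otimes> word_value G h w"
proof (induction v)
  case (Cons l v)
  moreover have "h (fst l) \<in> carrier G"
    using Cons.prems by auto
  ultimately show ?case
    by (cases l) (auto simp: m_assoc)
qed simp

lemma word_value_gen_pow [simp]:
  assumes "range h \<subseteq> carrier G"
  shows "word_value G h (gen_pow x k) = h x [^] k"
proof -
  have x: "h x \<in> carrier G"
    using assms by auto
  have "y \<otimes> y [^] j = y [^] j \<otimes> y" if "y \<in> carrier G" for y and j :: nat
    using nat_pow_Suc2[OF that] by simp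
  then have "word_value G h (replicate j (x, e)) = (if e then h x else inv h x) [^] j" for j e
    using x by (induction j) simp_all
  then show ?thesis
    using x by (auto simp: gen_pow_def int_pow_def2 nat_pow_inv simp del: pow_nat)
qed

lemma word_value_cong:
  assumes h: "range h \<subseteq> carrier G"
    and R: "\<And>u v. (u, v) \<in> R \<Longrightarrow> word_value G h u = word_value G h v"
    and "(u, v) \<in> word_cong R"
  shows "word_value G h u = word_value G h v"
  using assms(3)
proof (induction rule: word_cong.induct)
  case (cancel x e)
  have "h x \<in> carrier G"
    using h by auto
  then show ?case
    by simp
next
  case (rel u v)
  then show ?case
    by (rule R)
qed (simp_all add: h)

end

definition pres_gen :: "('g word \<times> 'g word) set \<Rightarrow> 'g \<Rightarrow> 'g word set" where
  "pres_gen R x = word_cong R `` {[(x, True)]}"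

lemma class_in_presented_group [simp]: "word_cong R `` {w} \<in> carrier (presented_group R)"
  by (simp add: presented_group_def quotientI)

lemma pres_gen_closed [simp]: "pres_gen R x \<in> carrier (presented_group R)"
  by (simp add: pres_gen_def)

lemma pres_gen_inv: "inv\<^bsub>presented_group R\<^esub> pres_gen R x = word_cong R `` {[(x, False)]}"
proof (rule group.inv_equality[OF group_presented_group])
  show "word_cong R `` {[(x, False)]} \<otimes>\<^bsub>presented_group R\<^esub> pres_gen R x = \<one>\<^bsub>presented_group R\<^esub>"
    using equiv_class_eq[OF equiv_word_cong word_cong.cancel[of x False R]]
    by (simp add: pres_gen_def presented_group_mult) (simp add: presented_group_def)
qed auto

lemma class_eq_word_value: "word_cong R `` {w} = word_value (presented_group R) (pres_gen R) w"
proof (induction w)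
  case Nil
  show ?case
    by (simp add: group.word_value_Nil[OF group_presented_group]) (simp add: presented_group_def)
next
  case (Cons l w)
  obtain x e where l: "l = (x, e)" by force
  have "word_cong R `` {l # w} =
      (if e then pres_gen R x else inv\<^bsub>presented_group R\<^esub> pres_gen R x)
        \<otimes>\<^bsub>presented_group R\<^esub> word_cong R `` {w}"
    by (simp add: pres_gen_inv l) (simp add: pres_gen_def presented_group_mult)
  then show ?case
    by (simp add: l Cons.IH group.word_value_Cons[OF group_presented_group])
qed

text \<open>
  Passing from words to their values turns the defining relations into equations between powers of the
  generators, where ordinary group theory applies.
\<close>

lemma presented_group_relation:
  assumes "(u, v) \<in> R"
  shows "word_value (presented_group R) (pres_gen R) u = word_value (presented_group R) (pres_gen R) v"
  using equiv_class_eq[OF equiv_word_cong word_cong.rel[OF assms]]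
  by (simp add: class_eq_word_value)

lemma presented_group_induct [consumes 1, case_names one gen inv]:
  assumes "U \<in> carrier (presented_group R)"
    and one: "P \<one>\<^bsub>presented_group R\<^esub>"
    and gen: "\<And>x V. V \<in> carrier (presented_group R) \<Longrightarrow> P V \<Longrightarrow> P (pres_gen R x \<otimes>\<^bsub>presented_group R\<^esub> V)"
    and inv: "\<And>x V. V \<in> carrier (presented_group R) \<Longrightarrow> P V \<Longrightarrow>
      P (inv\<^bsub>presented_group R\<^esub> pres_gen R x \<otimes>\<^bsub>presented_group R\<^esub> V)"
  shows "P U"
proof -
  interpret group "presented_group R"
    by (rule group_presented_group)
  have gens: "range (pres_gen R) \<subseteq> carrier (presented_group R)"
    by auto
  have "P (word_value (presented_group R) (pres_gen R) w)" for w
    by (induction w) (auto simp: one gen inv gens)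
  moreover obtain w where "U = word_cong R `` {w}"
    using assms(1) by (auto simp: presented_group_def elim!: quotientE)
  ultimately show ?thesis
    by (simp add: class_eq_word_value)
qed

text \<open>
  Von Dyck's theorem.
\<close>

lemma presented_group_hom:
  assumes "group S" and h: "range h \<subseteq> carrier S"
    and R: "\<And>u v. (u, v) \<in> R \<Longrightarrow> word_value S h u = word_value S h v"
  obtains f where "f \<in> hom (presented_group R) S" and "\<And>x. f (pres_gen R x) = h x"
proof -
  interpret S: group S by fact
  define f where "f U = word_value S h (SOME w. w \<in> U)" for U
  have f: "f (word_cong R `` {w}) = word_value S h w" for w
  proof -
    have "w \<in> word_cong R `` {w}"
      by (simp add: word_cong.refl)
    then have "(SOME v. v \<in> word_cong R `` {w}) \<in> word_cong R `` {w}"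
      by (rule someI)
    then have "(w, SOME v. v \<in> word_cong R `` {w}) \<in> word_cong R"
      by simp
    from S.word_value_cong[OF h R this] show ?thesis
      by (simp add: f_def)
  qed
  have "f \<in> hom (presented_group R) S"
  proof (rule homI)
    fix U V assume "U \<in> carrier (presented_group R)" "V \<in> carrier (presented_group R)"
    then obtain v w where "U = word_cong R `` {v}" "V = word_cong R `` {w}"
      by (auto simp: presented_group_def elim!: quotientE)
    then show "f (U \<otimes>\<^bsub>presented_group R\<^esub> V) = f U \<otimes>\<^bsub>S\<^esub> f V"
      using h by (simp add: presented_group_mult f)
  next
    fix U assume "U \<in> carrier (presented_group R)"
    then obtain v where "U = word_cong R `` {v}"
      by (auto simp: presented_group_def elim!: quotientE)
    then show "f U \<in> carrier S"
      using h by (simp add: f)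
  qed
  moreover have "f (pres_gen R x) = h x" for x
    using h by (simp add: pres_gen_def f range_subsetD)
  ultimately show thesis
    by (rule that)
qed

lemma presented_group_hom_eqI:
  assumes "group S" "f \<in> hom (presented_group R) S" "g \<in> hom (presented_group R) S"
    and "\<And>x. f (pres_gen R x) = g (pres_gen R x)"
    and "U \<in> carrier (presented_group R)"
  shows "f U = g U"
proof -
  interpret f: group_hom "presented_group R" S f
    by (simp add: group_hom_def group_hom_axioms_def assms group_presented_group)
  interpret g: group_hom "presented_group R" S g
    by (simp add: group_hom_def group_hom_axioms_def assms group_presented_group)
  show ?thesis
    using assms(5) by (induction rule: presented_group_induct) (simp_all add: assms(4))
qed

section \<open>A field with a quadratic basis over the integers modulo p\<close>

text \<open>
  The order of \<open>K\<close> forces characteristic \<open>p\<close>, and \<open>s\<close> is a square root of a non-square of the prime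
  field, so \<open>1\<close> and \<open>s\<close> form a basis of \<open>K\<close> over the prime field.
\<close>

locale quadratic_field = field K for K (structure) +
  fixes p :: nat and D :: int and s :: 'a
  assumes prime_p: "Factorial_Ring.prime p"
    and order_K: "order K = p ^ 2"
    and nonsquare: "\<not> QuadRes (int p) D"
    and s_closed [simp]: "s \<in> carrier K"
    and s_square: "s [^] (2::nat) = [D] \<cdot> \<one>"
begin

abbreviation num :: "int \<Rightarrow> 'a" where
  "num x \<equiv> [x] \<cdot> \<one>"

text \<open>
  Coordinates with respect to the basis \<open>1\<close>, \<open>s\<close>. They are integers rather than elements of the prime
  field because they occur as exponents of \<open>b\<close> and \<open>c\<close>; they are determined only modulo \<open>p\<close>.
\<close>

definition comb :: "int \<Rightarrow> int \<Rightarrow> 'a" where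
  "comb x y = num x \<oplus> num y \<otimes> s"

lemma num_closed [simp]: "num x \<in> carrier K"
  by (rule add.int_pow_closed) simp

lemma comb_closed [simp]: "comb x y \<in> carrier K"
  by (simp add: comb_def)

lemma num_add: "num (x + y) = num x \<oplus> num y"
  by (simp add: add.int_pow_mult)

lemma num_minus: "num (- x) = \<ominus> num x"
  by (simp add: add.int_pow_neg)

lemma num_mult: "num (x * y) = num x \<otimes> num y"
  using add.int_pow_pow[of \<one> x y] by (simp add: add_pow_ldistr_int mult.commute)

lemma num_simps [simp]: "num 0 = \<zero>" "num 1 = \<one>"
proof -
  show "num 0 = \<zero>"
    by (simp add: add_pow_def)
qed simp

lemma finite_K: "finite (carrier K)" "card (carrier K) = p ^ 2"
proof -
  show "card (carrier K) = p ^ 2"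
    using order_K by (simp add: order_def)
  moreover have "p ^ 2 \<noteq> 0"
    using prime_p by auto
  ultimately show "finite (carrier K)"
    by (metis card.infinite)
qed

text \<open>
  Lagrange's theorem for the additive group only yields \<open>p^2 \<cdot> 1 = 0\<close>; since this is the square
  of \<open>p \<cdot> 1\<close>, the characteristic is \<open>p\<close>.
\<close>

lemma num_p: "num (int p) = \<zero>"
proof -
  have "[(p ^ 2)] \<cdot> \<one> = \<zero>"
    using add.pow_order_eq_1[of \<one>] order_K by (simp add: order_def)
  moreover have "num (int p) \<otimes> num (int p) = num (int (p ^ 2))"
    by (simp only: power2_eq_square of_nat_mult num_mult)
  moreover have "num (int (p ^ 2)) = [(p ^ 2)] \<cdot> \<one>"
    by (simp only: add_pow_int_ge of_nat_0_le_iff nat_int)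
  ultimately have "num (int p) \<otimes> num (int p) = \<zero>"
    by simp
  then show ?thesis
    using integral by auto
qed

lemma bezout_inverse:
  assumes "\<not> int p dvd x"
  obtains x' t where "x * x' = 1 + int p * t"
proof -
  have "coprime x (int p)"
    using prime_imp_coprime[of "int p" x] assms prime_p by (simp add: coprime_commute)
  then obtain u v where "u * x + v * int p = 1"
    by (metis bezout_int coprime_imp_gcd_eq_1)
  then show thesis
    by (intro that[of u "- v"]) (simp add: algebra_simps)
qed

lemma num_eq_0_iff: "num x = \<zero> \<longleftrightarrow> int p dvd x"
proof
  show "int p dvd x \<Longrightarrow> num x = \<zero>"
    by (auto simp: num_mult num_p elim!: dvdE)
  show "int p dvd x" if "num x = \<zero>"
  proof (rule ccontr)
    assume "\<not> int p dvd x"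
    then obtain x' t where "x * x' = 1 + int p * t"
      by (rule bezout_inverse)
    from this[symmetric] have "num (1 + int p * t) = \<zero>"
      using that by (simp add: num_mult)
    then show False
      by (simp add: num_add num_mult num_p)
  qed
qed

lemma s_not_num: "s \<noteq> num t"
proof
  assume "s = num t"
  then have "num t \<otimes> num t = num D"
    using s_square by (simp add: numeral_2_eq_2)
  then have "num (t * t - D) = \<zero>"
    by (simp only: diff_conv_add_uminus num_add num_minus num_mult) (simp add: r_neg)
  then have "[t ^ 2 = D] (mod int p)"
    by (simp add: num_eq_0_iff cong_iff_dvd_diff power2_eq_square)
  then show False
    using nonsquare by (auto simp: QuadRes_def)
qed

text \<open>
  Linear independence of \<open>1\<close> and \<open>s\<close>: were \<open>y\<close> invertible modulo \<open>p\<close>, then \<open>s\<close> would lie in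
  the prime field and \<open>D\<close> would be a square.
\<close>

lemma comb_eq_0_iff: "comb x y = \<zero> \<longleftrightarrow> int p dvd x \<and> int p dvd y"
proof
  show "comb x y = \<zero>" if "int p dvd x \<and> int p dvd y"
    using that by (simp add: comb_def flip: num_eq_0_iff)
  assume 0: "comb x y = \<zero>"
  have "int p dvd y"
  proof (rule ccontr)
    assume "\<not> int p dvd y"
    then obtain y' t where y': "y * y' = 1 + int p * t"
      by (rule bezout_inverse)
    have "num y' \<otimes> comb x y = num (x * y') \<oplus> num (y * y') \<otimes> s"
      unfolding comb_def num_mult using num_closed s_closed by algebra
    also have "\<dots> = num (x * y') \<oplus> s"
      by (simp add: y' num_add num_mult[of "int p"] num_p)
    finally have "s = num (- (x * y'))"
      using 0 by (simp add: num_minus) (metis num_closed s_closed minus_equality a_comm minus_minus)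
    then show False
      using s_not_num by simp
  qed
  moreover from this have "int p dvd x"
    using 0 by (simp add: comb_def flip: num_eq_0_iff)
  ultimately show "int p dvd x \<and> int p dvd y"
    by simp
qed

lemma comb_add: "comb x y \<oplus> comb x' y' = comb (x + x') (y + y')"
  unfolding comb_def num_add using num_closed s_closed by algebra

lemma comb_minus: "\<ominus> comb x y = comb (- x) (- y)"
  unfolding comb_def num_minus using num_closed s_closed by algebra

lemma s_mult_s: "s \<otimes> s = num D"
  using s_square by (simp add: numeral_2_eq_2)

lemma comb_mult: "comb x y \<otimes> comb x' y' = comb (x * x' + D * y * y') (x * y' + y * x')"
proof -
  have "comb x y \<otimes> comb x' y' = num x \<otimes> num x' \<oplus> (s \<otimes> s) \<otimes> num y \<otimes> num y' \<oplus>
      (num x \<otimes> num y' \<oplus> num y \<otimes> num x') \<otimes> s"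
    unfolding comb_def using num_closed s_closed by algebra
  then show ?thesis
    by (simp add: comb_def num_add num_mult s_mult_s)
qed

lemma comb_basis: "comb x 0 = num x" "comb 0 1 = s"
  by (simp_all add: comb_def)

lemma comb_0_1: "comb 0 0 = \<zero>" "comb 1 0 = \<one>"
  by (simp_all add: comb_basis)

lemma comb_eq_iff: "comb x y = comb x' y' \<longleftrightarrow> int p dvd x - x' \<and> int p dvd y - y'"
proof -
  have "comb x y = comb x' y' \<longleftrightarrow> comb x y \<oplus> \<ominus> comb x' y' = \<zero>"
    by (metis comb_closed a_inv_closed minus_equality minus_minus r_neg)
  then show ?thesis
    by (simp add: comb_minus comb_add comb_eq_0_iff)
qed

text \<open>
  By counting: distinct pairs of residues give distinct elements, and there are \<open>p^2\<close> of each.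
\<close>

lemma comb_surj:
  assumes "z \<in> carrier K"
  obtains x y where "x \<in> {0..<int p}" "y \<in> {0..<int p}" "z = comb x y"
proof -
  let ?I = "{0..<int p} \<times> {0..<int p}"
  have "inj_on (case_prod comb) ?I"
  proof (clarsimp simp: inj_on_def comb_eq_iff)
    fix x y x' y'
    assume "0 \<le> x" "x < int p" "0 \<le> y" "y < int p" "0 \<le> x'" "x' < int p" "0 \<le> y'" "y' < int p"
      and "int p dvd x - x'" "int p dvd y - y'"
    then show "x = x' \<and> y = y'"
      by (metis mod_eq_dvd_iff mod_pos_pos_trivial)
  qed
  then have "card (case_prod comb ` ?I) = card (carrier K)"
    by (simp add: card_image card_cartesian_product finite_K power2_eq_square)
  then have "case_prod comb ` ?I = carrier K"
    by (intro card_subset_eq finite_K) auto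
  with assms obtain xy where "xy \<in> ?I" "z = case_prod comb xy"
    by blast
  then show thesis
    by (cases xy) (auto intro: that)
qed

text \<open>
  The nontrivial automorphism of \<open>K\<close>, which is the Frobenius map. In coordinates its
  additivity and multiplicativity are immediate, without the binomial theorem.
\<close>

definition conjugate :: "'a \<Rightarrow> 'a" where
  "conjugate z = (THE w. \<exists>x y. z = comb x y \<and> w = comb x (- y))"

lemma conjugate_comb [simp]: "conjugate (comb x y) = comb x (- y)"
  unfolding conjugate_def
proof (rule the_equality)
  fix w assume "\<exists>x' y'. comb x y = comb x' y' \<and> w = comb x' (- y')"
  then obtain x' y' where "int p dvd x - x'" "int p dvd y - y'" "w = comb x' (- y')"
    by (auto simp: comb_eq_iff)
  moreover from this have "int p dvd x' - x" "int p dvd - y' - - y"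
    by (simp_all add: dvd_diff_commute)
  ultimately show "w = comb x (- y)"
    by (simp add: comb_eq_iff)
qed auto

text \<open>
  The Galois group of \<open>K\<close>, indexed by truth values so that composition is exclusive or.
\<close>

definition gal :: "bool \<Rightarrow> 'a \<Rightarrow> 'a" where
  "gal e z = (if e then conjugate z else z)"

lemma gal_comb: "gal e (comb x y) = comb x (if e then - y else y)"
  by (simp add: gal_def)

lemma gal_closed [simp]: "z \<in> carrier K \<Longrightarrow> gal e z \<in> carrier K"
  by (erule comb_surj) (simp add: gal_comb)

lemma gal_add: "z \<in> carrier K \<Longrightarrow> w \<in> carrier K \<Longrightarrow> gal e (z \<oplus> w) = gal e z \<oplus> gal e w"
  by (elim comb_surj) (simp add: comb_add gal_comb add.commute)

lemma gal_mult: "z \<in> carrier K \<Longrightarrow> w \<in> carrier K \<Longrightarrow> gal e (z \<otimes> w) = gal e z \<otimes> gal e w"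
  by (elim comb_surj) (simp add: comb_mult gal_comb)

lemma gal_gal: "z \<in> carrier K \<Longrightarrow> gal e (gal e' z) = gal (e \<noteq> e') z"
  by (elim comb_surj) (simp add: gal_comb)

lemma gal_gal_same [simp]: "z \<in> carrier K \<Longrightarrow> gal e (gal e z) = z"
  by (elim comb_surj) (simp add: gal_comb)

lemma gal_False [simp]: "gal False z = z"
  by (simp add: gal_def)

lemma gal_0 [simp]: "gal e \<zero> = \<zero>" and gal_1 [simp]: "gal e \<one> = \<one>"
  using gal_comb[of e 0 0] gal_comb[of e 1 0] by (simp_all add: comb_0_1)

lemma gal_eq_iff [simp]: "z \<in> carrier K \<Longrightarrow> w \<in> carrier K \<Longrightarrow> gal e z = gal e w \<longleftrightarrow> z = w"
  by (metis gal_gal_same)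

lemma gal_eq_0_iff [simp]: "z \<in> carrier K \<Longrightarrow> gal e z = \<zero> \<longleftrightarrow> z = \<zero>"
  using gal_eq_iff[of z \<zero> e] by simp

lemma gal_pow: "z \<in> carrier K \<Longrightarrow> gal e (z [^] (j::nat)) = gal e z [^] j"
  by (induction j) (simp_all add: gal_mult)

section \<open>Semilinear affine permutations\<close>

text \<open>
  Restricted to \<open>carrier K\<close> because the permutation group consists of extensional functions.
\<close>

definition aff :: "'a \<Rightarrow> 'a \<Rightarrow> bool \<Rightarrow> 'a \<Rightarrow> 'a" where
  "aff v u e = (\<lambda>z\<in>carrier K. v \<oplus> u \<otimes> gal e z)"

abbreviation Perm :: "('a \<Rightarrow> 'a) monoid" where
  "Perm \<equiv> BijGroup (carrier K)"

lemma aff_closed: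
  assumes "v \<in> carrier K" "u \<in> carrier K" "u \<noteq> \<zero>"
  shows "aff v u e \<in> carrier Perm"
proof -
  have "inj_on (aff v u e) (carrier K)"
    using assms by (auto simp: inj_on_def aff_def m_lcancel)
  moreover have "aff v u e ` carrier K \<subseteq> carrier K"
    using assms by (auto simp: aff_def)
  ultimately have "bij_betw (aff v u e) (carrier K) (carrier K)"
    by (metis bij_betw_def endo_inj_surj finite_K(1))
  then show ?thesis
    by (simp add: BijGroup_def Bij_def) (simp add: aff_def)
qed

text \<open>
  This formula reduces every identity between permutations below to identities in \<open>K\<close>.
\<close>

lemma aff_mult:
  assumes "v \<in> carrier K" "u \<in> carrier K" "u \<noteq> \<zero>" "v' \<in> carrier K" "u' \<in> carrier K" "u' \<noteq> \<zero>"
  shows "aff v u e \<otimes>\<^bsub>Perm\<^esub> aff v' u' e' = aff (v \<oplus> u \<otimes> gal e v') (u \<otimes> gal e u') (e \<noteq> e')"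
proof -
  have "aff v u e \<otimes>\<^bsub>Perm\<^esub> aff v' u' e' = compose (carrier K) (aff v u e) (aff v' u' e')"
    using aff_closed assms by (simp add: BijGroup_def)
  also have "\<dots> = aff (v \<oplus> u \<otimes> gal e v') (u \<otimes> gal e u') (e \<noteq> e')"
    unfolding compose_def aff_def
    using assms by (intro restrict_ext) (simp add: gal_add gal_mult gal_gal r_distr a_assoc m_assoc)
  finally show ?thesis .
qed

lemma aff_one: "\<one>\<^bsub>Perm\<^esub> = aff \<zero> \<one> False"
  by (auto simp: BijGroup_def aff_def)

lemma s_neq_minus_s:
  assumes "odd p"
  shows "comb 0 1 \<noteq> comb 0 (- 1)"
proof
  assume "comb 0 1 = comb 0 (- 1)"
  then have "int p dvd 2"
    by (simp add: comb_eq_iff)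
  with assms prime_p show False
    by (metis int_dvd_int_iff of_nat_numeral primes_dvd_imp_eq two_is_prime_nat even_numeral)
qed

text \<open>
  A semilinear affine permutation is determined by its values at \<open>0\<close>, \<open>1\<close> and \<open>s\<close>; for odd \<open>p\<close> the
  value at \<open>s\<close> tells the two field automorphisms apart.
\<close>

lemma aff_eqD:
  assumes "odd p" "aff v u e = aff v' u' e'"
    and "v \<in> carrier K" "u \<in> carrier K" "u \<noteq> \<zero>" "v' \<in> carrier K" "u' \<in> carrier K"
  shows "v = v' \<and> u = u' \<and> e = e'"
proof -
  have at: "v \<oplus> u \<otimes> gal e z = v' \<oplus> u' \<otimes> gal e' z" if "z \<in> carrier K" for z
    using fun_cong[OF assms(2), of z] that by (simp add: aff_def)
  from at[of \<zero>] have "v = v'"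
    using assms by simp
  moreover from this at[of \<one>] have "u = u'"
    using assms by simp
  moreover from calculation at[of s] have "gal e s = gal e' s"
    using assms by (simp add: m_lcancel)
  then have "e = e'"
    using s_neq_minus_s[OF assms(1)] comb_basis(2) gal_comb[of _ 0 1] by (cases e; cases e') auto
  ultimately show ?thesis
    by simp
qed

lemma translation_hom: "(\<lambda>v. aff v \<one> False) \<in> hom (add_monoid K) Perm"
  by (intro homI) (simp_all add: aff_closed aff_mult)

abbreviation Kx :: "'a monoid" where
  "Kx \<equiv> Multiplicative_Group.mult_of K"

lemma scaling_hom: "(\<lambda>u. aff \<zero> u False) \<in> hom Kx Perm"
  by (intro homI) (simp_all add: aff_closed aff_mult)

end

locale primitive_quadratic_field = quadratic_field +
  fixes \<sigma> :: 'a
  assumes odd_p: "odd p"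
    and \<sigma>_unit: "\<sigma> \<in> carrier Kx"
    and \<sigma>_generates: "generate Kx {\<sigma>} = carrier Kx"
begin

sublocale M: group Kx
  by (rule field_mult_group)

lemma ord_\<sigma>: "M.ord \<sigma> = p ^ 2 - 1"
proof -
  have "M.ord \<sigma> = card (carrier Kx)"
    using M.generate_pow_card[OF \<sigma>_unit] by (simp add: \<sigma>_generates)
  then show ?thesis
    using finite_K by simp
qed

lemma \<sigma>_pow_surj:
  assumes "u \<in> carrier K" "u \<noteq> \<zero>"
  obtains j :: int where "j \<in> carrier (integer_mod_group (p ^ 2 - 1))" "u = \<sigma> [^]\<^bsub>Kx\<^esub> j"
proof -
  have "u \<in> generate Kx {\<sigma>}"
    using assms by (simp add: \<sigma>_generates)
  then obtain k :: int where k: "u = \<sigma> [^]\<^bsub>Kx\<^esub> k"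
    unfolding M.generate_pow[OF \<sigma>_unit] by auto
  let ?q = "int (p ^ 2 - 1)"
  have "1 < p ^ 2"
    using one_less_power[OF prime_gt_1_nat[OF prime_p], of 2] by simp
  then have "0 < ?q"
    by (simp only: of_nat_0_less_iff zero_less_diff)
  then have "k mod ?q \<in> carrier (integer_mod_group (p ^ 2 - 1))"
    using pos_mod_sign[of ?q k] pos_mod_bound[of ?q k]
    by (auto simp only: carrier_integer_mod_group atLeastLessThan_iff split: if_split)
  moreover have "\<sigma> [^]\<^bsub>Kx\<^esub> (k mod ?q) = u"
    using \<sigma>_unit unfolding k by (subst M.int_pow_eq) (simp_all add: ord_\<sigma> mod_eq_dvd_iff[symmetric])
  ultimately show thesis
    using that by simp
qed

text \<open>
  Conjugating the scaling by \<open>u\<close> with a field automorphism \<open>\<tau>\<close> gives the scaling by \<open>\<tau> u\<close>, and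
  conjugating the translation by \<open>v\<close> with an additive permutation \<open>h\<close> gives the translation by \<open>h v\<close>. So
  each of the two semidirect products is formed with the action by conjugation, and the resulting
  homomorphism sends \<open>((x, y), (j, e))\<close> to \<open>z \<mapsto> (x + y s) + \<sigma>^j \<tau>^e(z)\<close>.
\<close>

lemma semilinear_affine_group:
  obtains \<psi> \<phi> F where "\<psi> \<in> hom (integer_mod_group 2) (AutoGroup (integer_mod_group (p ^ 2 - 1)))"
    and "\<phi> \<in> hom (semidirect (integer_mod_group (p ^ 2 - 1)) (integer_mod_group 2) \<psi>)
      (AutoGroup (integer_mod_group p \<times>\<times> integer_mod_group p))"
    and "F \<in> hom (semidirect (integer_mod_group p \<times>\<times> integer_mod_group p)
      (semidirect (integer_mod_group (p ^ 2 - 1)) (integer_mod_group 2) \<psi>) \<phi>) Perm"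
    and "inj_on F (carrier (semidirect (integer_mod_group p \<times>\<times> integer_mod_group p)
      (semidirect (integer_mod_group (p ^ 2 - 1)) (integer_mod_group 2) \<psi>) \<phi>))"
    and "F ` carrier (semidirect (integer_mod_group p \<times>\<times> integer_mod_group p)
      (semidirect (integer_mod_group (p ^ 2 - 1)) (integer_mod_group 2) \<psi>) \<phi>) =
      {aff v u e | v u e. v \<in> carrier K \<and> u \<in> carrier K \<and> u \<noteq> \<zero>}"
proof -
  let ?V = "integer_mod_group p \<times>\<times> integer_mod_group p"
  let ?U = "integer_mod_group (p ^ 2 - 1)"
  let ?Z = "integer_mod_group 2"
  let ?f = "\<lambda>j::int. aff \<zero> (\<sigma> [^]\<^bsub>Kx\<^esub> j) False"
  let ?g = "\<lambda>e::int. aff \<zero> \<one> (e = 1)"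
  let ?t = "\<lambda>(x, y). aff (comb x y) \<one> False"
  have perm: "group Perm"
    by (rule group_BijGroup)
  have p0: "p \<noteq> 0" "p ^ 2 - 1 \<noteq> 0"
    using prime_gt_1_nat[OF prime_p] one_less_power[OF prime_gt_1_nat[OF prime_p], of 2]
    by (auto simp del: one_less_power)
  have \<sigma>_pow: "\<sigma> [^]\<^bsub>Kx\<^esub> j \<in> carrier K" "\<sigma> [^]\<^bsub>Kx\<^esub> j \<noteq> \<zero>" for j :: int
    using M.int_pow_closed[OF \<sigma>_unit, of j] by auto
  have Z: "e = 0 \<or> e = 1" if "e \<in> carrier ?Z" for e
    using that by (auto simp: carrier_integer_mod_group)
  have f: "?f \<in> hom ?U Perm"
  proof -
    have "\<sigma> [^]\<^bsub>Kx\<^esub> (p ^ 2 - 1) = \<one>\<^bsub>Kx\<^esub>"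
      using M.pow_ord_eq_1[OF \<sigma>_unit] by (simp add: ord_\<sigma>)
    from hom_compose[OF integer_mod_group_hom[OF M.is_group \<sigma>_unit this] scaling_hom]
    show ?thesis
      by (simp add: comp_def)
  qed
  have g: "?g \<in> hom ?Z Perm"
    by (intro homI) (auto simp: aff_closed aff_mult dest!: Z)
  have t: "?t \<in> hom ?V Perm"
  proof (rule homI)
    fix xy xy' assume "xy \<in> carrier ?V" "xy' \<in> carrier ?V"
    have "comb (x mod int p) (y mod int p) = comb x y" for x y
      by (simp add: comb_eq_iff mod_eq_dvd_iff[symmetric])
    then show "?t (xy \<otimes>\<^bsub>?V\<^esub> xy') = ?t xy \<otimes>\<^bsub>Perm\<^esub> ?t xy'"
      by (cases xy; cases xy') (simp add: aff_mult comb_add)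
  qed (auto simp: aff_closed)
  have f_inj: "inj_on ?f (carrier ?U)"
  proof (rule inj_onI)
    fix j j' assume jj': "j \<in> carrier ?U" "j' \<in> carrier ?U" "?f j = ?f j'"
    then have "\<sigma> [^]\<^bsub>Kx\<^esub> j = \<sigma> [^]\<^bsub>Kx\<^esub> j'"
      using aff_eqD[OF odd_p jj'(3)] \<sigma>_pow by simp
    then have "j' mod int (p ^ 2 - 1) = j mod int (p ^ 2 - 1)"
      using \<sigma>_unit by (simp only: M.int_pow_eq ord_\<sigma> mod_eq_dvd_iff)
    then show "j = j'"
      using jj'(1,2) p0 unfolding carrier_integer_mod_group by (simp only: if_False atLeastLessThan_iff) simp
  qed
  have t_inj: "inj_on ?t (carrier ?V)"
  proof (rule inj_onI)
    fix xy xy' assume xy: "xy \<in> carrier ?V" "xy' \<in> carrier ?V" "?t xy = ?t xy'"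
    obtain x y x' y' where eq: "xy = (x, y)" "xy' = (x', y')"
      by (cases xy; cases xy')
    from xy(3) have "aff (comb x y) \<one> False = aff (comb x' y') \<one> False"
      by (simp add: eq)
    then have "comb x y = comb x' y'"
      using aff_eqD[OF odd_p] by (metis comb_closed one_closed one_not_zero)
    then have "x mod int p = x' mod int p" "y mod int p = y' mod int p"
      by (simp_all add: comb_eq_iff mod_eq_dvd_iff)
    then show "xy = xy'"
      using xy(1,2) p0 by (simp add: eq carrier_integer_mod_group)
  qed
  obtain \<psi> where \<psi>: "\<psi> \<in> hom ?Z (AutoGroup ?U)"
    and \<psi>_conj: "\<And>j e. \<lbrakk>j \<in> carrier ?U; e \<in> carrier ?Z\<rbrakk> \<Longrightarrow>
      ?g e \<otimes>\<^bsub>Perm\<^esub> ?f j = ?f (\<psi> e j) \<otimes>\<^bsub>Perm\<^esub> ?g e"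
  proof (rule conjugation_action[OF _ _ perm f f_inj g])
    fix j e assume "j \<in> carrier ?U" "e \<in> carrier ?Z"
    obtain j' where "j' \<in> carrier ?U" "gal (e = 1) (\<sigma> [^]\<^bsub>Kx\<^esub> j) = \<sigma> [^]\<^bsub>Kx\<^esub> j'"
      using \<sigma>_pow_surj[of "gal (e = 1) (\<sigma> [^]\<^bsub>Kx\<^esub> j)"] \<sigma>_pow by auto
    then show "\<exists>j'\<in>carrier ?U. ?g e \<otimes>\<^bsub>Perm\<^esub> ?f j = ?f j' \<otimes>\<^bsub>Perm\<^esub> ?g e"
      using \<sigma>_pow by (intro bexI[of _ j']) (simp_all add: aff_mult)
  qed simp_all
  let ?H = "semidirect ?U ?Z \<psi>"
  let ?k = "\<lambda>(j, e). ?f j \<otimes>\<^bsub>Perm\<^esub> ?g e"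
  have H: "group ?H"
    by (rule group_semidirect[OF _ _ \<psi>]) simp_all
  have k: "?k \<in> hom ?H Perm"
    by (rule semidirect_hom[OF _ _ perm f g \<psi> \<psi>_conj]) simp_all
  have k_eq: "?k (j, e) = aff \<zero> (\<sigma> [^]\<^bsub>Kx\<^esub> j) (e = 1)" for j e
    using \<sigma>_pow by (simp add: aff_mult)
  have V: "group ?V"
    by (rule DirProd_group) simp_all
  have k_normal: "\<exists>xy'\<in>carrier ?V. ?k h \<otimes>\<^bsub>Perm\<^esub> ?t xy = ?t xy' \<otimes>\<^bsub>Perm\<^esub> ?k h" for xy h
  proof -
    obtain x y j e where eq: "xy = (x, y)" "h = (j, e)"
      by (cases xy; cases h)
    obtain x' y' where "x' \<in> {0..<int p}" "y' \<in> {0..<int p}"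
      and "\<sigma> [^]\<^bsub>Kx\<^esub> j \<otimes> gal (e = 1) (comb x y) = comb x' y'"
      using comb_surj[of "\<sigma> [^]\<^bsub>Kx\<^esub> j \<otimes> gal (e = 1) (comb x y)"] \<sigma>_pow by auto
    then show "\<exists>xy'\<in>carrier ?V. ?k h \<otimes>\<^bsub>Perm\<^esub> ?t xy = ?t xy' \<otimes>\<^bsub>Perm\<^esub> ?k h"
      using \<sigma>_pow p0 unfolding eq k_eq
      by (intro bexI[of _ "(x', y')"]) (simp_all add: aff_mult carrier_integer_mod_group)
  qed
  obtain \<phi> where \<phi>: "\<phi> \<in> hom ?H (AutoGroup ?V)"
    and \<phi>_conj: "\<And>xy h. \<lbrakk>xy \<in> carrier ?V; h \<in> carrier ?H\<rbrakk> \<Longrightarrow>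
      ?k h \<otimes>\<^bsub>Perm\<^esub> ?t xy = ?t (\<phi> h xy) \<otimes>\<^bsub>Perm\<^esub> ?k h"
    using conjugation_action[OF V H perm t t_inj k k_normal] by blast
  let ?W = "semidirect ?V ?H \<phi>"
  let ?F = "\<lambda>(xy, h). ?t xy \<otimes>\<^bsub>Perm\<^esub> ?k h"
  have F: "?F \<in> hom ?W Perm"
    by (rule semidirect_hom[OF V H perm t k \<phi> \<phi>_conj])
  have F_eq: "?F ((x, y), (j, e)) = aff (comb x y) (\<sigma> [^]\<^bsub>Kx\<^esub> j) (e = 1)" for x y j e
    using \<sigma>_pow by (simp add: aff_mult)
  have W: "w \<in> carrier ?W \<longleftrightarrow> (\<exists>x y j e. w = ((x, y), (j, e)) \<and> (x, y) \<in> carrier ?V \<and>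
      j \<in> carrier ?U \<and> e \<in> carrier ?Z)" for w
    by (auto simp: semidirect_def)
  have F_inj: "inj_on ?F (carrier ?W)"
  proof (rule inj_onI)
    fix w w' assume ww': "w \<in> carrier ?W" "w' \<in> carrier ?W" "?F w = ?F w'"
    obtain x y j e where w: "w = ((x, y), (j, e))" "(x, y) \<in> carrier ?V" "j \<in> carrier ?U" "e \<in> carrier ?Z"
      using ww'(1) W by blast
    obtain x' y' j' e' where w': "w' = ((x', y'), (j', e'))" "(x', y') \<in> carrier ?V" "j' \<in> carrier ?U" "e' \<in> carrier ?Z"
      using ww'(2) W by blast
    have "aff (comb x y) (\<sigma> [^]\<^bsub>Kx\<^esub> j) (e = 1) = aff (comb x' y') (\<sigma> [^]\<^bsub>Kx\<^esub> j') (e' = 1)"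
      using ww'(3) unfolding w(1) w'(1) F_eq .
    from aff_eqD[OF odd_p this] \<sigma>_pow
    have "comb x y = comb x' y'" "\<sigma> [^]\<^bsub>Kx\<^esub> j = \<sigma> [^]\<^bsub>Kx\<^esub> j'" "(e = 1) = (e' = 1)"
      by auto
    moreover from this have "(x, y) = (x', y')" "j = j'"
      using inj_onD[OF t_inj _ w(2) w'(2)] inj_onD[OF f_inj _ w(3) w'(3)] by auto
    ultimately show "w = w'"
      using Z[OF w(4)] Z[OF w'(4)] by (auto simp: w w')
  qed
  have "?F ` carrier ?W = {aff v u e | v u e. v \<in> carrier K \<and> u \<in> carrier K \<and> u \<noteq> \<zero>}"
  proof (intro equalityI subsetI)
    fix z assume "z \<in> ?F ` carrier ?W"
    then obtain w where "z = ?F w"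
      by blast
    moreover obtain x y j e where "w = ((x, y), (j, e))"
      by (metis surj_pair)
    ultimately have "z = ?F ((x, y), (j, e))"
      by (simp only:)
    then have "z = aff (comb x y) (\<sigma> [^]\<^bsub>Kx\<^esub> j) (e = 1)"
      unfolding F_eq .
    then show "z \<in> {aff v u e | v u e. v \<in> carrier K \<and> u \<in> carrier K \<and> u \<noteq> \<zero>}"
      using \<sigma>_pow comb_closed by blast
  next
    fix z assume "z \<in> {aff v u e | v u e. v \<in> carrier K \<and> u \<in> carrier K \<and> u \<noteq> \<zero>}"
    then obtain v u e where z: "z = aff v u e" "v \<in> carrier K" "u \<in> carrier K" "u \<noteq> \<zero>"
      by blast
    obtain x y where xy: "x \<in> {0..<int p}" "y \<in> {0..<int p}" "v = comb x y"
      using comb_surj z(2) by blast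
    obtain j where j: "j \<in> carrier ?U" "u = \<sigma> [^]\<^bsub>Kx\<^esub> j"
      using \<sigma>_pow_surj z(3,4) by blast
    let ?e = "if e then 1 else 0 :: int"
    have "z = ?F ((x, y), (j, ?e))"
      unfolding F_eq by (simp add: z(1) xy(3) j(2))
    moreover have "((x, y), (j, ?e)) \<in> carrier ?W"
      unfolding W using xy j p0 by (simp add: carrier_integer_mod_group)
    ultimately show "z \<in> ?F ` carrier ?W"
      by blast
  qed
  with \<psi> \<phi> F F_inj that show thesis
    by blast
qed

end

section \<open>Powers of commuting elements under conjugation\<close>

context group
begin

lemma int_pow_conjugate:
  assumes "x \<in> carrier G" "y \<in> carrier G"
  shows "inv x \<otimes> y [^] (k::int) \<otimes> x = (inv x \<otimes> y \<otimes> x) [^] k"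
proof -
  have cancel: "x \<otimes> (inv x \<otimes> w) = w" if "w \<in> carrier G" for w
    using assms(1) that by (simp flip: m_assoc)
  have "(\<lambda>y. inv x \<otimes> y \<otimes> x) \<in> hom G G"
    using assms(1) by (intro homI) (simp_all add: m_assoc cancel)
  from hom_int_pow[OF this assms(2) is_group is_group] show ?thesis .
qed

lemma int_pow_commute:
  assumes "y \<in> carrier G" "z \<in> carrier G" "y \<otimes> z = z \<otimes> y"
  shows "z [^] (l::int) \<otimes> y [^] (k::int) = y [^] k \<otimes> z [^] l"
proof -
  have *: "u [^] (j::int) \<otimes> v = v \<otimes> u [^] j"
    if "u \<in> carrier G" "v \<in> carrier G" "u \<otimes> v = v \<otimes> u" for u v j
  proof -
    have "inv v \<otimes> u \<otimes> v = u"
      using that by (simp add: m_assoc inv_solve_left')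
    then have "inv v \<otimes> (u [^] j \<otimes> v) = u [^] j"
      using int_pow_conjugate[of v u j] that by (simp add: m_assoc)
    then show ?thesis
      using that by (metis int_pow_closed inv_solve_left m_closed)
  qed
  show ?thesis
    using assms *[of z y l] *[of y "z [^] l" k] by simp
qed

text \<open>
  The relations of \<open>G\<close> prescribe conjugates of \<open>b\<close> and \<open>c\<close> under \<open>a\<close> in this form; they
  allow moving \<open>inv a\<close> past any product of powers of \<open>b\<close> and \<open>c\<close>.
\<close>

lemma conjugate_commuting_pair:
  assumes "x \<in> carrier G" "y \<in> carrier G" "z \<in> carrier G" and comm: "y \<otimes> z = z \<otimes> y"
    and conj: "inv x \<otimes> y \<otimes> x = y [^] (m1::int) \<otimes> z [^] (m2::int)"
      "inv x \<otimes> z \<otimes> x = y [^] (n1::int) \<otimes> z [^] (n2::int)"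
  shows "inv x \<otimes> (y [^] k \<otimes> z [^] l) = (y [^] (m1 * k + n1 * l) \<otimes> z [^] (m2 * k + n2 * l)) \<otimes> inv x"
proof -
  have yz: "z [^] (l::int) \<otimes> y [^] (k::int) = y [^] k \<otimes> z [^] l" for k l
    using int_pow_commute[OF assms(2,3) comm] .
  have cancel: "x \<otimes> (inv x \<otimes> w) = w" if "w \<in> carrier G" for w
    using assms(1) that by (simp flip: m_assoc)
  have "inv x \<otimes> (y [^] k \<otimes> z [^] l) \<otimes> x = (inv x \<otimes> y [^] k \<otimes> x) \<otimes> (inv x \<otimes> z [^] l \<otimes> x)"
    using assms(1-3) by (simp add: m_assoc cancel)
  also have "\<dots> = (y [^] m1 \<otimes> z [^] m2) [^] k \<otimes> (y [^] n1 \<otimes> z [^] n2) [^] l"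
    using assms(1-3) by (simp add: int_pow_conjugate conj)
  also have "\<dots> = (y [^] (m1 * k) \<otimes> z [^] (m2 * k)) \<otimes> (y [^] (n1 * l) \<otimes> z [^] (n2 * l))"
    using assms(2,3) by (simp add: int_pow_mult_distrib yz int_pow_pow)
  also have "\<dots> = y [^] (m1 * k) \<otimes> (z [^] (m2 * k) \<otimes> y [^] (n1 * l)) \<otimes> z [^] (n2 * l)"
    using assms(2,3) by (simp add: m_assoc)
  also have "\<dots> = y [^] (m1 * k + n1 * l) \<otimes> z [^] (m2 * k + n2 * l)"
    using assms(2,3) by (simp add: yz int_pow_mult m_assoc)
  finally have "inv x \<otimes> (y [^] k \<otimes> z [^] l) \<otimes> x = y [^] (m1 * k + n1 * l) \<otimes> z [^] (m2 * k + n2 * l)" .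
  then show ?thesis
    using assms(1-3) by (metis inv_closed int_pow_closed inv_solve_right m_closed)
qed

end

section \<open>Normal forms in the presented group\<close>

locale presentation_over_field = primitive_quadratic_field +
  fixes m n :: int
  assumes \<iota>_\<sigma>: "comb m n = \<sigma> [^]\<^bsub>Kx\<^esub> ((p ^ 2 - 1) div 4)"
    and n_unit: "\<not> int p dvd n"
begin

abbreviation \<iota> :: 'a where
  "\<iota> \<equiv> comb m n"

abbreviation rels :: "(abc word \<times> abc word) set" where
  "rels \<equiv> G_rels p D m n"

abbreviation \<Gamma> :: "abc word set monoid" where
  "\<Gamma> \<equiv> presented_group rels"

sublocale \<Gamma>: group \<Gamma>
  by (rule group_presented_group)

abbreviation A :: "abc word set" where "A \<equiv> pres_gen rels abc.a"
abbreviation B :: "abc word set" where "B \<equiv> pres_gen rels abc.b"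
abbreviation C :: "abc word set" where "C \<equiv> pres_gen rels abc.c"

lemma relations_\<Gamma>:
  "A [^]\<^bsub>\<Gamma>\<^esub> (4::int) = \<one>\<^bsub>\<Gamma>\<^esub>" "B [^]\<^bsub>\<Gamma>\<^esub> int p = \<one>\<^bsub>\<Gamma>\<^esub>" "C [^]\<^bsub>\<Gamma>\<^esub> int p = \<one>\<^bsub>\<Gamma>\<^esub>"
  "B \<otimes>\<^bsub>\<Gamma>\<^esub> C = C \<otimes>\<^bsub>\<Gamma>\<^esub> B"
  "inv\<^bsub>\<Gamma>\<^esub> A \<otimes>\<^bsub>\<Gamma>\<^esub> B \<otimes>\<^bsub>\<Gamma>\<^esub> A = B [^]\<^bsub>\<Gamma>\<^esub> m \<otimes>\<^bsub>\<Gamma>\<^esub> C [^]\<^bsub>\<Gamma>\<^esub> (n * D)"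
  "inv\<^bsub>\<Gamma>\<^esub> A \<otimes>\<^bsub>\<Gamma>\<^esub> C \<otimes>\<^bsub>\<Gamma>\<^esub> A = B [^]\<^bsub>\<Gamma>\<^esub> n \<otimes>\<^bsub>\<Gamma>\<^esub> C [^]\<^bsub>\<Gamma>\<^esub> m"
proof -
  have gens: "range (pres_gen rels) \<subseteq> carrier \<Gamma>"
    by auto
  have in_rels: "(gen_pow abc.a 4, []) \<in> rels" "(gen_pow abc.b (int p), []) \<in> rels"
    "(gen_pow abc.c (int p), []) \<in> rels"
    "(gen_pow abc.b (-1) @ gen_pow abc.c (-1) @ gen_pow abc.b 1 @ gen_pow abc.c 1, []) \<in> rels"
    "(gen_pow abc.a (-1) @ gen_pow abc.b 1 @ gen_pow abc.a 1, gen_pow abc.b m @ gen_pow abc.c (n * D)) \<in> rels"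
    "(gen_pow abc.a (-1) @ gen_pow abc.c 1 @ gen_pow abc.a 1, gen_pow abc.b n @ gen_pow abc.c m) \<in> rels"
    unfolding G_rels_def by simp_all
  show "A [^]\<^bsub>\<Gamma>\<^esub> (4::int) = \<one>\<^bsub>\<Gamma>\<^esub>"
    using presented_group_relation[OF in_rels(1)] by (simp add: gens)
  show "B [^]\<^bsub>\<Gamma>\<^esub> int p = \<one>\<^bsub>\<Gamma>\<^esub>"
    using presented_group_relation[OF in_rels(2)]
    by (simp add: gens del: int_pow_int)
  show "C [^]\<^bsub>\<Gamma>\<^esub> int p = \<one>\<^bsub>\<Gamma>\<^esub>"
    using presented_group_relation[OF in_rels(3)]
    by (simp add: gens del: int_pow_int)
  have "inv\<^bsub>\<Gamma>\<^esub> B \<otimes>\<^bsub>\<Gamma>\<^esub> (inv\<^bsub>\<Gamma>\<^esub> C \<otimes>\<^bsub>\<Gamma>\<^esub> (B \<otimes>\<^bsub>\<Gamma>\<^esub> C)) = \<one>\<^bsub>\<Gamma>\<^esub>"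
    using presented_group_relation[OF in_rels(4)]
    by (simp add: gens \<Gamma>.int_pow_neg)
  then have "inv\<^bsub>\<Gamma>\<^esub> (C \<otimes>\<^bsub>\<Gamma>\<^esub> B) \<otimes>\<^bsub>\<Gamma>\<^esub> (B \<otimes>\<^bsub>\<Gamma>\<^esub> C) = \<one>\<^bsub>\<Gamma>\<^esub>"
    by (simp add: \<Gamma>.inv_mult_group \<Gamma>.m_assoc)
  then show "B \<otimes>\<^bsub>\<Gamma>\<^esub> C = C \<otimes>\<^bsub>\<Gamma>\<^esub> B"
    using \<Gamma>.inv_equality[of "inv\<^bsub>\<Gamma>\<^esub> (C \<otimes>\<^bsub>\<Gamma>\<^esub> B)" "B \<otimes>\<^bsub>\<Gamma>\<^esub> C"] by (metis \<Gamma>.inv_inv \<Gamma>.inv_closed \<Gamma>.m_closed pres_gen_closed \<Gamma>.inv_equality)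
  show "inv\<^bsub>\<Gamma>\<^esub> A \<otimes>\<^bsub>\<Gamma>\<^esub> B \<otimes>\<^bsub>\<Gamma>\<^esub> A = B [^]\<^bsub>\<Gamma>\<^esub> m \<otimes>\<^bsub>\<Gamma>\<^esub> C [^]\<^bsub>\<Gamma>\<^esub> (n * D)"
    using presented_group_relation[OF in_rels(5)]
    by (simp add: gens \<Gamma>.int_pow_neg \<Gamma>.m_assoc)
  show "inv\<^bsub>\<Gamma>\<^esub> A \<otimes>\<^bsub>\<Gamma>\<^esub> C \<otimes>\<^bsub>\<Gamma>\<^esub> A = B [^]\<^bsub>\<Gamma>\<^esub> n \<otimes>\<^bsub>\<Gamma>\<^esub> C [^]\<^bsub>\<Gamma>\<^esub> m"
    using presented_group_relation[OF in_rels(6)]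
    by (simp add: gens \<Gamma>.int_pow_neg \<Gamma>.m_assoc)
qed

text \<open>
  The products in normal form are closed under left multiplication by every generator and its
  inverse. The relations move \<open>inv a\<close> to the right past \<open>b\<close> and \<open>c\<close>; multiplication by \<open>a\<close> is
  reduced to this case by \<open>a = (inv a) ^ 3\<close>.
\<close>

lemma normal_form:
  assumes "U \<in> carrier \<Gamma>"
  obtains x y k :: int where "U = (B [^]\<^bsub>\<Gamma>\<^esub> x \<otimes>\<^bsub>\<Gamma>\<^esub> C [^]\<^bsub>\<Gamma>\<^esub> y) \<otimes>\<^bsub>\<Gamma>\<^esub> A [^]\<^bsub>\<Gamma>\<^esub> k"
proof -
  define N where "N = {(B [^]\<^bsub>\<Gamma>\<^esub> x \<otimes>\<^bsub>\<Gamma>\<^esub> C [^]\<^bsub>\<Gamma>\<^esub> y) \<otimes>\<^bsub>\<Gamma>\<^esub> A [^]\<^bsub>\<Gamma>\<^esub> k | (x::int) (y::int) (k::int). True}"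
  have N_intro: "(B [^]\<^bsub>\<Gamma>\<^esub> x \<otimes>\<^bsub>\<Gamma>\<^esub> C [^]\<^bsub>\<Gamma>\<^esub> y) \<otimes>\<^bsub>\<Gamma>\<^esub> A [^]\<^bsub>\<Gamma>\<^esub> k \<in> N" for x y k :: int
    unfolding N_def by blast
  have N_closed: "V \<in> carrier \<Gamma>" if "V \<in> N" for V
    using that by (auto simp: N_def)
  have invA: "inv\<^bsub>\<Gamma>\<^esub> A \<otimes>\<^bsub>\<Gamma>\<^esub> V \<in> N" if V: "V \<in> N" for V
  proof -
    obtain x y k :: int where "V = (B [^]\<^bsub>\<Gamma>\<^esub> x \<otimes>\<^bsub>\<Gamma>\<^esub> C [^]\<^bsub>\<Gamma>\<^esub> y) \<otimes>\<^bsub>\<Gamma>\<^esub> A [^]\<^bsub>\<Gamma>\<^esub> k"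
      using V by (auto simp: N_def)
    then have "inv\<^bsub>\<Gamma>\<^esub> A \<otimes>\<^bsub>\<Gamma>\<^esub> V = (inv\<^bsub>\<Gamma>\<^esub> A \<otimes>\<^bsub>\<Gamma>\<^esub> (B [^]\<^bsub>\<Gamma>\<^esub> x \<otimes>\<^bsub>\<Gamma>\<^esub> C [^]\<^bsub>\<Gamma>\<^esub> y)) \<otimes>\<^bsub>\<Gamma>\<^esub> A [^]\<^bsub>\<Gamma>\<^esub> k"
      by (simp add: \<Gamma>.m_assoc)
    also have "\<dots> = (B [^]\<^bsub>\<Gamma>\<^esub> (m * x + n * y) \<otimes>\<^bsub>\<Gamma>\<^esub> C [^]\<^bsub>\<Gamma>\<^esub> (n * D * x + m * y)) \<otimes>\<^bsub>\<Gamma>\<^esub>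
        inv\<^bsub>\<Gamma>\<^esub> A \<otimes>\<^bsub>\<Gamma>\<^esub> A [^]\<^bsub>\<Gamma>\<^esub> k"
      by (subst \<Gamma>.conjugate_commuting_pair[OF _ _ _ relations_\<Gamma>(4-6)]) simp_all
    also have "\<dots> = (B [^]\<^bsub>\<Gamma>\<^esub> (m * x + n * y) \<otimes>\<^bsub>\<Gamma>\<^esub> C [^]\<^bsub>\<Gamma>\<^esub> (n * D * x + m * y)) \<otimes>\<^bsub>\<Gamma>\<^esub> A [^]\<^bsub>\<Gamma>\<^esub> (- 1 + k)"
      by (simp only: \<Gamma>.int_pow_mult pres_gen_closed \<Gamma>.int_pow_neg \<Gamma>.int_pow_1) (simp add: \<Gamma>.m_assoc)
    finally show ?thesis
      by (simp only: N_intro)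
  qed
  have A: "A \<otimes>\<^bsub>\<Gamma>\<^esub> V \<in> N" if V: "V \<in> N" for V
  proof -
    have "A = inv\<^bsub>\<Gamma>\<^esub> A \<otimes>\<^bsub>\<Gamma>\<^esub> (inv\<^bsub>\<Gamma>\<^esub> A \<otimes>\<^bsub>\<Gamma>\<^esub> inv\<^bsub>\<Gamma>\<^esub> A)"
    proof -
      have "A = A [^]\<^bsub>\<Gamma>\<^esub> (1 - 4 :: int)"
        by (simp only: \<Gamma>.int_pow_diff relations_\<Gamma>(1) pres_gen_closed) simp
      also have "(1 - 4 :: int) = - 1 + (- 1 + - 1)"
        by simp
      finally show ?thesis
        by (simp only: \<Gamma>.int_pow_mult pres_gen_closed \<Gamma>.int_pow_neg \<Gamma>.int_pow_1)
    qed
    then have "A \<otimes>\<^bsub>\<Gamma>\<^esub> V = inv\<^bsub>\<Gamma>\<^esub> A \<otimes>\<^bsub>\<Gamma>\<^esub> (inv\<^bsub>\<Gamma>\<^esub> A \<otimes>\<^bsub>\<Gamma>\<^esub> (inv\<^bsub>\<Gamma>\<^esub> A \<otimes>\<^bsub>\<Gamma>\<^esub> V))"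
      using N_closed[OF V] by (metis \<Gamma>.m_assoc \<Gamma>.inv_closed \<Gamma>.m_closed pres_gen_closed)
    with V show ?thesis
      by (simp only: invA)
  qed
  have BC: "B [^]\<^bsub>\<Gamma>\<^esub> z \<otimes>\<^bsub>\<Gamma>\<^esub> V \<in> N" "C [^]\<^bsub>\<Gamma>\<^esub> z \<otimes>\<^bsub>\<Gamma>\<^esub> V \<in> N" if V_N: "V \<in> N" for V and z :: int
  proof -
    obtain x y k :: int where V: "V = (B [^]\<^bsub>\<Gamma>\<^esub> x \<otimes>\<^bsub>\<Gamma>\<^esub> C [^]\<^bsub>\<Gamma>\<^esub> y) \<otimes>\<^bsub>\<Gamma>\<^esub> A [^]\<^bsub>\<Gamma>\<^esub> k"
      using V_N by (auto simp: N_def)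
    have "B [^]\<^bsub>\<Gamma>\<^esub> z \<otimes>\<^bsub>\<Gamma>\<^esub> V = (B [^]\<^bsub>\<Gamma>\<^esub> (z + x) \<otimes>\<^bsub>\<Gamma>\<^esub> C [^]\<^bsub>\<Gamma>\<^esub> y) \<otimes>\<^bsub>\<Gamma>\<^esub> A [^]\<^bsub>\<Gamma>\<^esub> k"
      by (simp add: V \<Gamma>.int_pow_mult \<Gamma>.m_assoc)
    then show "B [^]\<^bsub>\<Gamma>\<^esub> z \<otimes>\<^bsub>\<Gamma>\<^esub> V \<in> N"
      by (simp only: N_intro)
    have "C [^]\<^bsub>\<Gamma>\<^esub> z \<otimes>\<^bsub>\<Gamma>\<^esub> V = (C [^]\<^bsub>\<Gamma>\<^esub> z \<otimes>\<^bsub>\<Gamma>\<^esub> B [^]\<^bsub>\<Gamma>\<^esub> x) \<otimes>\<^bsub>\<Gamma>\<^esub> (C [^]\<^bsub>\<Gamma>\<^esub> y \<otimes>\<^bsub>\<Gamma>\<^esub> A [^]\<^bsub>\<Gamma>\<^esub> k)"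
      by (simp add: V \<Gamma>.m_assoc)
    also have "C [^]\<^bsub>\<Gamma>\<^esub> z \<otimes>\<^bsub>\<Gamma>\<^esub> B [^]\<^bsub>\<Gamma>\<^esub> x = B [^]\<^bsub>\<Gamma>\<^esub> x \<otimes>\<^bsub>\<Gamma>\<^esub> C [^]\<^bsub>\<Gamma>\<^esub> z"
      by (rule \<Gamma>.int_pow_commute[OF _ _ relations_\<Gamma>(4)]) simp_all
    also have "B [^]\<^bsub>\<Gamma>\<^esub> x \<otimes>\<^bsub>\<Gamma>\<^esub> C [^]\<^bsub>\<Gamma>\<^esub> z \<otimes>\<^bsub>\<Gamma>\<^esub> (C [^]\<^bsub>\<Gamma>\<^esub> y \<otimes>\<^bsub>\<Gamma>\<^esub> A [^]\<^bsub>\<Gamma>\<^esub> k) =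
        (B [^]\<^bsub>\<Gamma>\<^esub> x \<otimes>\<^bsub>\<Gamma>\<^esub> C [^]\<^bsub>\<Gamma>\<^esub> (z + y)) \<otimes>\<^bsub>\<Gamma>\<^esub> A [^]\<^bsub>\<Gamma>\<^esub> k"
      by (simp add: \<Gamma>.int_pow_mult \<Gamma>.m_assoc)
    finally show "C [^]\<^bsub>\<Gamma>\<^esub> z \<otimes>\<^bsub>\<Gamma>\<^esub> V \<in> N"
      by (simp only: N_intro)
  qed
  have "U \<in> N"
    using assms
  proof (induction rule: presented_group_induct)
    case one
    show ?case
      using N_intro[of 0 0 0] by simp
  next
    case (gen x V)
    then show ?case
      using A[of V] BC[of V 1] by (cases x) simp_all
  next
    case (inv x V)
    then show ?case
      using invA[of V] BC[of V "- 1"] by (cases x) (simp_all add: \<Gamma>.int_pow_neg)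
  qed
  with that show thesis
    by (auto simp: N_def)
qed

end

section \<open>The presented group as a group of affine permutations\<close>

context presentation_over_field
begin

lemma four_dvd: "p ^ 2 - 1 = 4 * ((p ^ 2 - 1) div 4)"
proof -
  obtain k where "p = 2 * k + 1"
    using odd_p by (rule oddE)
  then have "p ^ 2 - 1 = 4 * (k * k + k)"
    by (simp add: power2_eq_square algebra_simps)
  then show ?thesis
    by simp
qed

lemma order_pos: "p ^ 2 - 1 \<noteq> 0"
  using one_less_power[OF prime_gt_1_nat[OF prime_p], of 2] by (simp del: one_less_power)

lemma \<iota>_unit [simp]: "\<iota> \<in> carrier Kx"
  unfolding \<iota>_\<sigma> using \<sigma>_unit by (rule M.nat_pow_closed)

lemma \<iota>_nonzero [simp]: "\<iota> \<noteq> \<zero>"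
  using \<iota>_unit by simp

lemma ord_\<iota>: "M.ord \<iota> = 4"
proof -
  let ?q = "(p ^ 2 - 1) div 4"
  have q: "?q \<noteq> 0"
    using four_dvd order_pos by (metis mult_0_right)
  have "M.ord \<iota> = (p ^ 2 - 1) div ?q"
    unfolding \<iota>_\<sigma> ord_\<sigma>[symmetric]
    by (rule M.ord_pow[OF \<sigma>_unit]) (use four_dvd q in \<open>metis ord_\<sigma> dvd_triv_right\<close>, use q in \<open>simp add: ord_\<sigma>\<close>)
  also have "\<dots> = 4"
    using four_dvd q by (metis nonzero_mult_div_cancel_right)
  finally show ?thesis .
qed

text \<open>
  The scalar by which \<open>a\<close> acts. Multiplication of permutations is composition and the relations
  describe \<open>inv a \<otimes> b \<otimes> a\<close>, so it is \<open>inv a\<close> that acts as \<open>\<iota>\<close>.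
\<close>

definition \<rho> :: 'a where
  "\<rho> = inv\<^bsub>Kx\<^esub> \<iota>"

lemma \<rho>_unit: "\<rho> \<in> carrier Kx"
  unfolding \<rho>_def by (rule M.inv_closed) (rule \<iota>_unit)

lemma \<rho>_closed [simp]: "\<rho> \<in> carrier K" and \<rho>_nonzero [simp]: "\<rho> \<noteq> \<zero>"
  using \<rho>_unit by simp_all

lemma \<rho>_\<iota>: "\<rho> \<otimes> \<iota> = \<one>"
  using M.l_inv[OF \<iota>_unit] by (simp add: \<rho>_def)

lemma ord_\<rho>: "M.ord \<rho> = 4"
  unfolding \<rho>_def using M.ord_inv[OF \<iota>_unit] by (simp add: ord_\<iota>)

lemma \<rho>_pow_closed [simp]: "\<rho> [^]\<^bsub>Kx\<^esub> (k::int) \<in> carrier K" "\<rho> [^]\<^bsub>Kx\<^esub> k \<noteq> \<zero>"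
  using M.int_pow_closed[OF \<rho>_unit, of k] by simp_all

lemma \<rho>_neq_1: "\<rho> \<noteq> \<one>"
  using M.ord_eq_1[OF \<rho>_unit] ord_\<rho> by simp

definition fourth_roots :: "'a set" where
  "fourth_roots = {r \<in> carrier K. r [^] (4::nat) = \<one>}"

lemma fourth_root_unit:
  assumes "r \<in> fourth_roots"
  shows "r \<in> carrier Kx"
  using assms by (auto simp: fourth_roots_def numeral_eq_Suc)

text \<open>
  The multiplicative group is cyclic of order \<open>4 q\<close> with generator \<open>\<sigma>\<close>, so its fourth roots of unity
  are exactly the powers of \<open>\<sigma> ^ q = \<iota>\<close>.
\<close>

lemma fourth_roots_eq: "fourth_roots = range (\<lambda>k::int. \<rho> [^]\<^bsub>Kx\<^esub> k)"
proof (intro equalityI subsetI)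
  fix r assume "r \<in> range (\<lambda>k::int. \<rho> [^]\<^bsub>Kx\<^esub> k)"
  then obtain k :: int where r: "r = \<rho> [^]\<^bsub>Kx\<^esub> k"
    by blast
  have "r [^]\<^bsub>Kx\<^esub> int 4 = \<rho> [^]\<^bsub>Kx\<^esub> (k * int 4)"
    unfolding r by (rule M.int_pow_pow[OF \<rho>_unit])
  also have "\<dots> = \<one>\<^bsub>Kx\<^esub>"
    by (simp only: M.int_pow_eq_id[OF \<rho>_unit] ord_\<rho>) simp
  finally have "r [^]\<^bsub>Kx\<^esub> (4::nat) = \<one>\<^bsub>Kx\<^esub>"
    by (simp only: int_pow_int)
  then show "r \<in> fourth_roots"
    by (simp add: fourth_roots_def Multiplicative_Group.nat_pow_mult_of) (simp add: r)
next
  fix r assume r: "r \<in> fourth_roots"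
  let ?q = "(p ^ 2 - 1) div 4"
  obtain j :: int where j: "r = \<sigma> [^]\<^bsub>Kx\<^esub> j"
    using \<sigma>_pow_surj[of r] fourth_root_unit[OF r] by auto
  have "r [^]\<^bsub>Kx\<^esub> int 4 = \<one>\<^bsub>Kx\<^esub>"
    using r by (simp only: int_pow_int Multiplicative_Group.nat_pow_mult_of) (simp add: fourth_roots_def)
  then have "\<sigma> [^]\<^bsub>Kx\<^esub> (j * int 4) = \<one>\<^bsub>Kx\<^esub>"
    unfolding j by (simp only: M.int_pow_pow[OF \<sigma>_unit])
  then have "int (4 * ?q) dvd j * int 4"
    unfolding M.int_pow_eq_id[OF \<sigma>_unit] ord_\<sigma> using four_dvd by simp
  then have "int ?q dvd j"
    by (simp add: mult.commute)
  then obtain t where "j = int ?q * t"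
    by (rule dvdE)
  then have "r = \<iota> [^]\<^bsub>Kx\<^esub> t"
    unfolding j \<iota>_\<sigma> by (simp only: M.int_pow_pow[OF \<sigma>_unit] int_pow_int[symmetric])
  also have "\<dots> = \<rho> [^]\<^bsub>Kx\<^esub> (- t)"
    unfolding \<rho>_def by (simp only: M.int_pow_inv M.int_pow_neg \<iota>_unit M.inv_closed M.int_pow_closed M.inv_inv)
  finally show "r \<in> range (\<lambda>k::int. \<rho> [^]\<^bsub>Kx\<^esub> k)"
    by blast
qed

lemma gal_fourth_root: "r \<in> fourth_roots \<Longrightarrow> gal e r \<in> fourth_roots"
  using gal_pow[of r e 4, symmetric] by (simp add: fourth_roots_def)

lemma translation_num_pow:
  assumes "v \<in> carrier K"
  shows "aff v \<one> False [^]\<^bsub>Perm\<^esub> (k::int) = aff (num k \<otimes> v) \<one> False"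
  using hom_int_pow[OF translation_hom _ a_group group_BijGroup, of v k] assms
    add_pow_ldistr_int[of \<one> v k]
  by (simp add: add_pow_def)

lemma translation_pow:
  "aff (comb x y) \<one> False [^]\<^bsub>Perm\<^esub> (k::int) = aff (comb (k * x) (k * y)) \<one> False"
  using comb_mult[of k 0 x y] by (simp add: translation_num_pow comb_basis)

lemma scaling_pow:
  "u \<in> carrier Kx \<Longrightarrow> aff \<zero> u False [^]\<^bsub>Perm\<^esub> (k::int) = aff \<zero> (u [^]\<^bsub>Kx\<^esub> k) False"
  using hom_int_pow[OF scaling_hom _ M.is_group group_BijGroup, of u k] by simp

text \<open>
  The affine representation of \<open>G\<close> on \<open>K\<close>, under which \<open>b\<close> and \<open>c\<close> become the translations by \<open>s\<close> and \<open>1\<close>.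
  Von Dyck's theorem provides it only as an existence statement.
\<close>

definition rep :: "abc word set \<Rightarrow> 'a \<Rightarrow> 'a" where
  "rep = (SOME f. f \<in> hom \<Gamma> Perm \<and>
    f A = aff \<zero> \<rho> False \<and> f B = aff (comb 0 1) \<one> False \<and> f C = aff (comb 1 0) \<one> False)"

lemma rep:
  shows rep_hom: "rep \<in> hom \<Gamma> Perm"
    and rep_A: "rep A = aff \<zero> \<rho> False"
    and rep_B: "rep B = aff (comb 0 1) \<one> False"
    and rep_C: "rep C = aff (comb 1 0) \<one> False"
proof -
  interpret P: group Perm
    by (rule group_BijGroup)
  have \<rho>_pow: "\<rho> [^]\<^bsub>Kx\<^esub> (4::int) = \<one>" "\<rho> [^]\<^bsub>Kx\<^esub> (- 1 :: int) = \<iota>" "\<rho> [^]\<^bsub>Kx\<^esub> (1 :: int) = \<rho>"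
  proof -
    have "\<rho> [^]\<^bsub>Kx\<^esub> (4::int) = \<one>\<^bsub>Kx\<^esub>"
      by (simp only: M.int_pow_eq_id[OF \<rho>_unit] ord_\<rho>) simp
    then show "\<rho> [^]\<^bsub>Kx\<^esub> (4::int) = \<one>"
      by simp
    show "\<rho> [^]\<^bsub>Kx\<^esub> (- 1 :: int) = \<iota>" "\<rho> [^]\<^bsub>Kx\<^esub> (1 :: int) = \<rho>"
      using \<rho>_unit M.inv_inv[OF \<iota>_unit] by (simp_all only: M.int_pow_neg M.int_pow_1 \<rho>_def)
  qed
  have comb_p: "comb 0 (int p) = \<zero>" "comb (int p) 0 = \<zero>"
    by (simp_all add: comb_eq_0_iff)
  have \<rho>_\<iota>': "\<iota> \<otimes> \<rho> = \<one>"
    using \<rho>_\<iota> by (simp add: m_comm)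
  define h where "h = case_abc (aff \<zero> \<rho> False) (aff (comb 0 1) \<one> False) (aff (comb 1 0) \<one> False)"
  have h_gen: "h abc.a = aff \<zero> \<rho> False" "h abc.b = aff (comb 0 1) \<one> False"
    "h abc.c = aff (comb 1 0) \<one> False"
    by (simp_all add: h_def)
  have h: "range h \<subseteq> carrier Perm"
    by (auto simp: h_def aff_closed split: abc.split)
  have "word_value Perm h u = word_value Perm h v" if "(u, v) \<in> rels" for u v
    using that h \<rho>_\<iota>' unfolding G_rels_def
    by (auto simp: h_gen translation_pow scaling_pow[OF \<rho>_unit] \<rho>_pow aff_mult comb_add comb_mult
        comb_p comb_0_1(1) aff_one mult.commute simp del: P.int_pow_1)
  then obtain f where "f \<in> hom \<Gamma> Perm" "\<And>x. f (pres_gen rels x) = h x"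
    using presented_group_hom[OF group_BijGroup h, of rels] by blast
  then have "\<exists>f. f \<in> hom \<Gamma> Perm \<and> f A = aff \<zero> \<rho> False \<and>
      f B = aff (comb 0 1) \<one> False \<and> f C = aff (comb 1 0) \<one> False"
    by (intro exI[of _ f]) (simp only: h_gen simp_thms)
  from someI_ex[OF this] show "rep \<in> hom \<Gamma> Perm" "rep A = aff \<zero> \<rho> False"
    "rep B = aff (comb 0 1) \<one> False" "rep C = aff (comb 1 0) \<one> False"
    by (simp_all only: rep_def simp_thms)
qed

sublocale rep: group_hom \<Gamma> Perm rep
  by (simp add: group_hom_def group_hom_axioms_def group_BijGroup group_presented_group rep_hom)

lemma rep_normal_form:
  "rep ((B [^]\<^bsub>\<Gamma>\<^esub> (x::int) \<otimes>\<^bsub>\<Gamma>\<^esub> C [^]\<^bsub>\<Gamma>\<^esub> (y::int)) \<otimes>\<^bsub>\<Gamma>\<^esub> A [^]\<^bsub>\<Gamma>\<^esub> (k::int)) =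
    aff (comb y x) (\<rho> [^]\<^bsub>Kx\<^esub> k) False"
  by (simp add: rep.hom_int_pow rep_A rep_B rep_C translation_pow
      scaling_pow[OF \<rho>_unit] aff_mult comb_add)

lemma rep_image: "rep ` carrier \<Gamma> = {aff v r False | v r. v \<in> carrier K \<and> r \<in> fourth_roots}"
proof (intro equalityI subsetI)
  fix z assume "z \<in> rep ` carrier \<Gamma>"
  then obtain U where "U \<in> carrier \<Gamma>" "z = rep U"
    by blast
  moreover from this(1) obtain x y k :: int
    where "U = (B [^]\<^bsub>\<Gamma>\<^esub> x \<otimes>\<^bsub>\<Gamma>\<^esub> C [^]\<^bsub>\<Gamma>\<^esub> y) \<otimes>\<^bsub>\<Gamma>\<^esub> A [^]\<^bsub>\<Gamma>\<^esub> k"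
    by (rule normal_form)
  ultimately have "z = aff (comb y x) (\<rho> [^]\<^bsub>Kx\<^esub> k) False"
    by (simp only: rep_normal_form)
  then show "z \<in> {aff v r False | v r. v \<in> carrier K \<and> r \<in> fourth_roots}"
    unfolding fourth_roots_eq using comb_closed by blast
next
  fix z assume "z \<in> {aff v r False | v r. v \<in> carrier K \<and> r \<in> fourth_roots}"
  then obtain v k where z: "z = aff v (\<rho> [^]\<^bsub>Kx\<^esub> (k::int)) False" "v \<in> carrier K"
    unfolding fourth_roots_eq by blast
  obtain x y where "v = comb x y"
    using comb_surj z(2) by blast
  then have "z = rep ((B [^]\<^bsub>\<Gamma>\<^esub> y \<otimes>\<^bsub>\<Gamma>\<^esub> C [^]\<^bsub>\<Gamma>\<^esub> x) \<otimes>\<^bsub>\<Gamma>\<^esub> A [^]\<^bsub>\<Gamma>\<^esub> k)"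
    by (simp only: rep_normal_form z)
  moreover have "(B [^]\<^bsub>\<Gamma>\<^esub> y \<otimes>\<^bsub>\<Gamma>\<^esub> C [^]\<^bsub>\<Gamma>\<^esub> x) \<otimes>\<^bsub>\<Gamma>\<^esub> A [^]\<^bsub>\<Gamma>\<^esub> k \<in> carrier \<Gamma>"
    by simp
  ultimately show "z \<in> rep ` carrier \<Gamma>"
    by blast
qed

text \<open>
  A word \<open>b^x c^y a^k\<close> acting trivially has \<open>y + x s = 0\<close> and \<open>\<rho>^k = 1\<close>, so \<open>p\<close> divides \<open>x\<close> and \<open>y\<close>, and
  \<open>4\<close> divides \<open>k\<close>; the power relations then make the word trivial.
\<close>

lemma rep_inj: "inj_on rep (carrier \<Gamma>)"
proof (unfold rep.inj_on_one_iff, intro allI impI)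
  fix U assume "U \<in> carrier \<Gamma>" "rep U = \<one>\<^bsub>Perm\<^esub>"
  obtain x y k :: int where U: "U = (B [^]\<^bsub>\<Gamma>\<^esub> x \<otimes>\<^bsub>\<Gamma>\<^esub> C [^]\<^bsub>\<Gamma>\<^esub> y) \<otimes>\<^bsub>\<Gamma>\<^esub> A [^]\<^bsub>\<Gamma>\<^esub> k"
    using \<open>U \<in> carrier \<Gamma>\<close> by (rule normal_form)
  have "aff (comb y x) (\<rho> [^]\<^bsub>Kx\<^esub> k) False = aff \<zero> \<one> False"
    using \<open>rep U = \<one>\<^bsub>Perm\<^esub>\<close> by (simp only: U rep_normal_form aff_one)
  from aff_eqD[OF odd_p this] have "comb y x = \<zero>" and k: "\<rho> [^]\<^bsub>Kx\<^esub> k = \<one>\<^bsub>Kx\<^esub>"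
    by simp_all
  then have "int p dvd x" "int p dvd y"
    by (simp_all add: comb_eq_0_iff)
  have "4 dvd k"
    using k by (simp only: M.int_pow_eq_id[OF \<rho>_unit] ord_\<rho>) simp
  have trivial: "g [^]\<^bsub>\<Gamma>\<^esub> l = \<one>\<^bsub>\<Gamma>\<^esub>"
    if "g \<in> carrier \<Gamma>" "g [^]\<^bsub>\<Gamma>\<^esub> d = \<one>\<^bsub>\<Gamma>\<^esub>" "d dvd l" for g and d l :: int
  proof -
    have "int (\<Gamma>.ord g) dvd d"
      using that(2) by (simp only: \<Gamma>.int_pow_eq_id[OF that(1)])
    then have "int (\<Gamma>.ord g) dvd l"
      using that(3) by (rule dvd_trans)
    then show ?thesis
      by (simp only: \<Gamma>.int_pow_eq_id[OF that(1)])
  qed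
  then have "B [^]\<^bsub>\<Gamma>\<^esub> x = \<one>\<^bsub>\<Gamma>\<^esub>" "C [^]\<^bsub>\<Gamma>\<^esub> y = \<one>\<^bsub>\<Gamma>\<^esub>" "A [^]\<^bsub>\<Gamma>\<^esub> k = \<one>\<^bsub>\<Gamma>\<^esub>"
    using trivial[OF pres_gen_closed relations_\<Gamma>(1) \<open>4 dvd k\<close>]
      trivial[OF pres_gen_closed relations_\<Gamma>(2) \<open>int p dvd x\<close>]
      trivial[OF pres_gen_closed relations_\<Gamma>(3) \<open>int p dvd y\<close>]
    by (simp_all only:)
  then show "U = \<one>\<^bsub>\<Gamma>\<^esub>"
    by (simp only: U \<Gamma>.l_one \<Gamma>.one_closed)
qed

lemma rep_eq_iff: "U \<in> carrier \<Gamma> \<Longrightarrow> V \<in> carrier \<Gamma> \<Longrightarrow> rep U = rep V \<longleftrightarrow> U = V"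
  using rep_inj by (auto dest: inj_onD)

lemma rep_form:
  assumes "U \<in> carrier \<Gamma>"
  obtains v r where "rep U = aff v r False" "v \<in> carrier K" "r \<in> fourth_roots"
  using assms rep_image by blast

text \<open>
  Conjugating \<open>z \<mapsto> t + r z\<close> with a semilinear affine permutation replaces \<open>r\<close> by its image under the
  field automorphism, which is again a fourth root of unity.
\<close>

lemma rep_normalised:
  assumes "v \<in> carrier K" "u \<in> carrier K" "u \<noteq> \<zero>" and U: "U \<in> carrier \<Gamma>"
  shows "\<exists>V\<in>carrier \<Gamma>. aff v u e \<otimes>\<^bsub>Perm\<^esub> rep U = rep V \<otimes>\<^bsub>Perm\<^esub> aff v u e"
proof -
  obtain t r where r: "rep U = aff t r False" "t \<in> carrier K" "r \<in> fourth_roots"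
    using U by (rule rep_form)
  let ?r = "gal e r"
  let ?t = "v \<oplus> u \<otimes> gal e t \<ominus> ?r \<otimes> v"
  have r': "r \<in> carrier K" "r \<noteq> \<zero>"
    using fourth_root_unit[OF r(3)] by simp_all
  have "?t \<in> carrier K"
    using assms r(2) r' by simp
  then have "aff ?t ?r False \<in> rep ` carrier \<Gamma>"
    unfolding rep_image using gal_fourth_root[OF r(3)] by blast
  then obtain V where V: "V \<in> carrier \<Gamma>" "rep V = aff ?t ?r False"
    by force
  have "?t \<oplus> ?r \<otimes> v = v \<oplus> u \<otimes> gal e t"
    using assms(1-3) r(2) r' by (simp add: minus_eq a_assoc l_neg)
  moreover have "?r \<otimes> u = u \<otimes> ?r"
    using assms(1-3) r' by (simp add: m_comm)
  ultimately have "aff v u e \<otimes>\<^bsub>Perm\<^esub> rep U = rep V \<otimes>\<^bsub>Perm\<^esub> aff v u e"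
    using assms(1-3) r(2) r' by (simp add: r(1) V(2) aff_mult)
  with V(1) show ?thesis
    by blast
qed

text \<open>
  The linear part \<open>r\<close> satisfies both \<open>r ^ p = 1\<close> and \<open>r ^ 4 = 1\<close>, and \<open>p\<close> is odd.
\<close>

lemma rep_order_p:
  assumes U: "U \<in> carrier \<Gamma>" "U [^]\<^bsub>\<Gamma>\<^esub> int p = \<one>\<^bsub>\<Gamma>\<^esub>"
  obtains v where "v \<in> carrier K" "rep U = aff v \<one> False"
proof -
  obtain t r where r: "rep U = aff t r False" "t \<in> carrier K" "r \<in> fourth_roots"
    using U(1) by (rule rep_form)
  have r': "r \<in> carrier K" "r \<noteq> \<zero>" "r \<in> carrier Kx"
    using fourth_root_unit[OF r(3)] by simp_all
  have pow: "\<exists>t'\<in>carrier K. rep U [^]\<^bsub>Perm\<^esub> (k::nat) = aff t' (r [^] k) False" for k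
  proof (induction k)
    case 0
    show ?case
      by (intro bexI[of _ \<zero>]) (simp_all add: aff_one)
  next
    case (Suc k)
    then obtain t' where "t' \<in> carrier K" "rep U [^]\<^bsub>Perm\<^esub> k = aff t' (r [^] k) False"
      by blast
    moreover have "r [^] k \<noteq> \<zero>"
      using M.nat_pow_closed[OF r'(3), of k] by (simp add: Multiplicative_Group.nat_pow_mult_of)
    ultimately show ?case
      using r(2) r' by (intro bexI[of _ "t' \<oplus> r [^] k \<otimes> t"]) (simp_all add: r(1) aff_mult)
  qed
  have "rep U [^]\<^bsub>Perm\<^esub> p = \<one>\<^bsub>Perm\<^esub>"
    using U rep.hom_nat_pow[OF U(1), of p] by (simp add: int_pow_int)
  with pow[of p] obtain t' where "t' \<in> carrier K" "aff \<zero> \<one> False = aff t' (r [^] p) False"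
    by (auto simp: aff_one)
  then have "r [^]\<^bsub>Kx\<^esub> p = \<one>\<^bsub>Kx\<^esub>"
    using aff_eqD[OF odd_p] r' by (fastforce simp: Multiplicative_Group.nat_pow_mult_of)
  then have "M.ord r dvd p"
    using M.pow_eq_id[OF r'(3)] by simp
  moreover have "r [^]\<^bsub>Kx\<^esub> (4::nat) = \<one>\<^bsub>Kx\<^esub>"
    using r(3) by (simp add: fourth_roots_def Multiplicative_Group.nat_pow_mult_of)
  then have "M.ord r dvd 2 ^ 2"
    using M.pow_eq_id[OF r'(3), of 4] by simp
  moreover have "coprime p (2 ^ 2)"
    using odd_p by (simp only: coprime_power_right_iff coprime_right_2_iff_odd) simp
  ultimately have "M.ord r = 1"
    by (metis coprime_common_divisor nat_dvd_1_iff_1)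
  then have "r = \<one>"
    using M.ord_eq_1[OF r'(3)] by simp
  with r that show thesis
    by simp
qed

section \<open>Automorphisms as conjugations by semilinear affine permutations\<close>

text \<open>
  Let \<open>\<alpha>\<close> send \<open>b\<close>, \<open>c\<close>, \<open>a\<close> to \<open>z \<mapsto> z + \<beta>\<close>, \<open>z \<mapsto> z + \<gamma>\<close>, \<open>z \<mapsto> w z + v\<close>, and let \<open>t\<close> be
  the inverse of \<open>w\<close> minus \<open>m\<close>. The images of the conjugation relations say \<open>t \<beta> = n D \<gamma>\<close> and
  \<open>t \<gamma> = n \<beta>\<close>. Hence \<open>t^2 \<gamma> = (n s)^2 \<gamma>\<close>, and \<open>\<gamma> \<noteq> 0\<close> leaves \<open>t = \<plusminus> n s\<close>. For the field automorphism
  \<open>\<tau>\<close> with this sign, \<open>\<beta> = \<gamma> \<tau>(s)\<close> and \<open>w = \<tau>(\<rho>)\<close>, so \<open>\<alpha>\<close> agrees on \<open>b\<close> and \<open>c\<close> with conjugation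
  by \<open>z \<mapsto> v' + \<gamma> \<tau>(z)\<close> for any \<open>v'\<close>. The generator \<open>a\<close> requires \<open>v' = w v' + v\<close>, that is, \<open>v'\<close> is
  the fixed point of the image of \<open>a\<close>, which exists because \<open>w \<noteq> 1\<close>.
\<close>

lemma automorphism_is_conjugation:
  assumes \<alpha>: "\<alpha> \<in> carrier (AutoGroup \<Gamma>)"
  obtains v u e where "v \<in> carrier K" "u \<in> carrier K" "u \<noteq> \<zero>"
    and "\<And>x. aff v u e \<otimes>\<^bsub>Perm\<^esub> rep (pres_gen rels x) = rep (\<alpha> (pres_gen rels x)) \<otimes>\<^bsub>Perm\<^esub> aff v u e"
proof -
  have \<alpha>_hom: "\<alpha> \<in> hom \<Gamma> \<Gamma>" and \<alpha>_inj: "inj_on \<alpha> (carrier \<Gamma>)"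
    using \<alpha> by (auto simp: AutoGroup_def auto_def Bij_def bij_betw_def)
  interpret \<alpha>: group_hom \<Gamma> \<Gamma> \<alpha>
    by (simp add: group_hom_def group_hom_axioms_def group_presented_group \<alpha>_hom)
  have "\<alpha> B [^]\<^bsub>\<Gamma>\<^esub> int p = \<one>\<^bsub>\<Gamma>\<^esub>" "\<alpha> C [^]\<^bsub>\<Gamma>\<^esub> int p = \<one>\<^bsub>\<Gamma>\<^esub>"
    by (simp_all only: \<alpha>.hom_int_pow[symmetric] pres_gen_closed relations_\<Gamma> \<alpha>.hom_one)
  then obtain \<beta> \<gamma> where \<beta>: "\<beta> \<in> carrier K" "rep (\<alpha> B) = aff \<beta> \<one> False"
    and \<gamma>: "\<gamma> \<in> carrier K" "rep (\<alpha> C) = aff \<gamma> \<one> False"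
    using rep_order_p[of "\<alpha> B"] rep_order_p[of "\<alpha> C"] by (metis \<alpha>.hom_closed pres_gen_closed)
  obtain v w where w: "rep (\<alpha> A) = aff v w False" "v \<in> carrier K" "w \<in> fourth_roots"
    using rep_form[of "\<alpha> A"] by auto
  have w': "w \<in> carrier K" "w \<noteq> \<zero>"
    using fourth_root_unit[OF w(3)] by simp_all
  have \<gamma>_nonzero: "\<gamma> \<noteq> \<zero>"
  proof
    assume "\<gamma> = \<zero>"
    then have "rep (\<alpha> C) = rep (\<alpha> \<one>\<^bsub>\<Gamma>\<^esub>)"
      by (simp add: \<gamma> aff_one)
    then have "\<alpha> C = \<alpha> \<one>\<^bsub>\<Gamma>\<^esub>"
      by (subst (asm) rep_eq_iff) (simp_all only: \<alpha>.hom_closed pres_gen_closed \<Gamma>.one_closed)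
    then have "C = \<one>\<^bsub>\<Gamma>\<^esub>"
      using \<alpha>_inj by (metis inj_onD pres_gen_closed \<Gamma>.one_closed)
    then have "aff (comb 1 0) \<one> False = aff \<zero> \<one> False"
      using rep_C rep.hom_one by (simp add: aff_one)
    from aff_eqD[OF odd_p this] show False
      by (simp add: comb_0_1)
  qed
  have pow: "rep (\<alpha> B) [^]\<^bsub>Perm\<^esub> k = aff (num k \<otimes> \<beta>) \<one> False"
    "rep (\<alpha> C) [^]\<^bsub>Perm\<^esub> k = aff (num k \<otimes> \<gamma>) \<one> False" for k :: int
    using translation_num_pow \<beta> \<gamma> by simp_all
  have \<alpha>_rel: "\<alpha> y \<otimes>\<^bsub>\<Gamma>\<^esub> \<alpha> A = \<alpha> A \<otimes>\<^bsub>\<Gamma>\<^esub> (\<alpha> B [^]\<^bsub>\<Gamma>\<^esub> k \<otimes>\<^bsub>\<Gamma>\<^esub> \<alpha> C [^]\<^bsub>\<Gamma>\<^esub> l)"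
    if "y \<in> carrier \<Gamma>" "inv\<^bsub>\<Gamma>\<^esub> A \<otimes>\<^bsub>\<Gamma>\<^esub> y \<otimes>\<^bsub>\<Gamma>\<^esub> A = B [^]\<^bsub>\<Gamma>\<^esub> k \<otimes>\<^bsub>\<Gamma>\<^esub> C [^]\<^bsub>\<Gamma>\<^esub> l" for y and k l :: int
  proof -
    have "y \<otimes>\<^bsub>\<Gamma>\<^esub> A = A \<otimes>\<^bsub>\<Gamma>\<^esub> (B [^]\<^bsub>\<Gamma>\<^esub> k \<otimes>\<^bsub>\<Gamma>\<^esub> C [^]\<^bsub>\<Gamma>\<^esub> l)"
      unfolding that(2)[symmetric] using that(1) by (simp flip: \<Gamma>.m_assoc)
    then have "\<alpha> (y \<otimes>\<^bsub>\<Gamma>\<^esub> A) = \<alpha> (A \<otimes>\<^bsub>\<Gamma>\<^esub> (B [^]\<^bsub>\<Gamma>\<^esub> k \<otimes>\<^bsub>\<Gamma>\<^esub> C [^]\<^bsub>\<Gamma>\<^esub> l))"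
      by simp
    then show ?thesis
      using that(1) by (simp add: \<alpha>.hom_int_pow)
  qed
  have field_rel: "\<eta> = w \<otimes> (num k \<otimes> \<beta> \<oplus> num l \<otimes> \<gamma>)"
    if "\<alpha> y \<otimes>\<^bsub>\<Gamma>\<^esub> \<alpha> A = \<alpha> A \<otimes>\<^bsub>\<Gamma>\<^esub> (\<alpha> B [^]\<^bsub>\<Gamma>\<^esub> k \<otimes>\<^bsub>\<Gamma>\<^esub> \<alpha> C [^]\<^bsub>\<Gamma>\<^esub> l)"
      and y: "y \<in> carrier \<Gamma>" "rep (\<alpha> y) = aff \<eta> \<one> False" "\<eta> \<in> carrier K" for y \<eta> and k l :: int
  proof -
    have "rep (\<alpha> y \<otimes>\<^bsub>\<Gamma>\<^esub> \<alpha> A) = rep (\<alpha> A \<otimes>\<^bsub>\<Gamma>\<^esub> (\<alpha> B [^]\<^bsub>\<Gamma>\<^esub> k \<otimes>\<^bsub>\<Gamma>\<^esub> \<alpha> C [^]\<^bsub>\<Gamma>\<^esub> l))"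
      by (simp only: that(1))
    then have "aff (\<eta> \<oplus> v) w False = aff (v \<oplus> w \<otimes> (num k \<otimes> \<beta> \<oplus> num l \<otimes> \<gamma>)) w False"
      using y \<beta>(1) \<gamma>(1) w(2) w' by (simp add: rep.hom_int_pow pow w(1) aff_mult)
    from aff_eqD[OF odd_p this] have "v \<oplus> \<eta> = v \<oplus> w \<otimes> (num k \<otimes> \<beta> \<oplus> num l \<otimes> \<gamma>)"
      using y(3) \<beta>(1) \<gamma>(1) w(2) w' by (simp add: a_comm)
    then show ?thesis
      using y(3) \<beta>(1) \<gamma>(1) w(2) w' by simp
  qed
  have \<beta>_rel: "\<beta> = w \<otimes> (num m \<otimes> \<beta> \<oplus> num (n * D) \<otimes> \<gamma>)"
    by (rule field_rel[OF \<alpha>_rel[OF _ relations_\<Gamma>(5)]]) (simp_all add: \<beta>)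
  have \<gamma>_rel: "\<gamma> = w \<otimes> (num n \<otimes> \<beta> \<oplus> num m \<otimes> \<gamma>)"
    by (rule field_rel[OF \<alpha>_rel[OF _ relations_\<Gamma>(6)]]) (simp_all add: \<gamma>)
  obtain e where e: "\<beta> = \<gamma> \<otimes> gal e (comb 0 1)" "w = gal e \<rho>"
  proof -
    let ?q = "inv w"
    have q: "?q \<in> carrier K" "?q \<otimes> w = \<one>"
      using w' by (simp_all add: field_Units)
    have cancel: "?q \<otimes> (w \<otimes> z) = z" if "z \<in> carrier K" for z
      using q w' that by (simp flip: m_assoc)
    define t where "t = ?q \<ominus> num m"
    have t: "t \<in> carrier K" "?q = t \<oplus> num m"
      unfolding t_def using q(1) num_closed[of m] by algebra+
    have q\<beta>: "?q \<otimes> \<beta> = num m \<otimes> \<beta> \<oplus> num (n * D) \<otimes> \<gamma>"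
      using arg_cong[OF \<beta>_rel, of "\<lambda>z. ?q \<otimes> z"] \<beta>(1) \<gamma>(1) by (simp add: cancel)
    have q\<gamma>: "?q \<otimes> \<gamma> = num n \<otimes> \<beta> \<oplus> num m \<otimes> \<gamma>"
      using arg_cong[OF \<gamma>_rel, of "\<lambda>z. ?q \<otimes> z"] \<beta>(1) \<gamma>(1) by (simp add: cancel)
    have t\<beta>: "t \<otimes> \<beta> = num n \<otimes> num D \<otimes> \<gamma>"
    proof -
      have "num m \<otimes> \<beta> \<oplus> t \<otimes> \<beta> = num m \<otimes> \<beta> \<oplus> num n \<otimes> num D \<otimes> \<gamma>"
        using q\<beta> \<beta>(1) t by (simp add: num_mult l_distr a_comm)
      then show ?thesis
        using \<beta>(1) \<gamma>(1) t(1) by simp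
    qed
    have t\<gamma>: "t \<otimes> \<gamma> = num n \<otimes> \<beta>"
    proof -
      have "num m \<otimes> \<gamma> \<oplus> t \<otimes> \<gamma> = num m \<otimes> \<gamma> \<oplus> num n \<otimes> \<beta>"
        using q\<gamma> \<beta>(1) \<gamma>(1) t by (simp add: l_distr a_comm)
      then show ?thesis
        using \<beta>(1) \<gamma>(1) t(1) by simp
    qed
    \<comment> \<open>eliminate \<open>\<beta>\<close> between the two relations: \<open>t (t \<gamma>) = n (t \<beta>) = n^2 D \<gamma>\<close>\<close>
    have "(t \<ominus> num n \<otimes> s) \<otimes> (t \<oplus> num n \<otimes> s) \<otimes> \<gamma> =
        t \<otimes> (t \<otimes> \<gamma>) \<ominus> num n \<otimes> (num n \<otimes> (s \<otimes> s) \<otimes> \<gamma>)"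
      using t(1) \<gamma>(1) num_closed[of n] s_closed by algebra
    also have "t \<otimes> (t \<otimes> \<gamma>) = num n \<otimes> (t \<otimes> \<beta>)"
      unfolding t\<gamma> using t(1) \<beta>(1) num_closed[of n] by algebra
    also have "num n \<otimes> (t \<otimes> \<beta>) \<ominus> num n \<otimes> (num n \<otimes> (s \<otimes> s) \<otimes> \<gamma>) = \<zero>"
      unfolding t\<beta> s_mult_s using \<gamma>(1) num_closed[of n] num_closed[of D] by algebra
    finally have "(t \<ominus> num n \<otimes> s) \<otimes> (t \<oplus> num n \<otimes> s) = \<zero>"
      using t(1) \<gamma>(1) \<gamma>_nonzero by (simp add: integral_iff)
    then have "t \<ominus> num n \<otimes> s = \<zero> \<or> t \<oplus> num n \<otimes> s = \<zero>"
      using t(1) by (simp add: integral_iff)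
    then have "t = num n \<otimes> comb 0 1 \<or> t = num n \<otimes> comb 0 (- 1)"
    proof
      assume "t \<ominus> num n \<otimes> s = \<zero>"
      then show ?thesis
        using t(1) by (simp add: comb_basis(2))
    next
      assume "t \<oplus> num n \<otimes> s = \<zero>"
      then have "t = \<ominus> (num n \<otimes> s)"
        using t(1) by (simp add: sum_zero_eq_neg)
      also have "\<dots> = num n \<otimes> comb 0 (- 1)"
      proof -
        have "comb 0 (- 1) = \<ominus> s"
          using comb_minus[of 0 1] by (simp add: comb_basis(2))
        then show ?thesis
          by (simp add: r_minus)
      qed
      finally show ?thesis ..
    qed
    then have "\<exists>e. t = num n \<otimes> gal e (comb 0 1)"
      by (auto simp: gal_comb intro: exI[of _ False] exI[of _ True])
    then obtain e where e: "t = num n \<otimes> gal e (comb 0 1)"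
      by blast
    have "num n \<otimes> (\<gamma> \<otimes> gal e (comb 0 1)) = num n \<otimes> \<beta>"
      using t\<gamma> \<gamma>(1) unfolding e by (simp add: m_ac)
    then have "\<beta> = \<gamma> \<otimes> gal e (comb 0 1)"
      using \<beta>(1) \<gamma>(1) n_unit by (simp add: m_lcancel num_eq_0_iff)
    moreover have "w = gal e \<rho>"
    proof -
      have "gal e \<iota> = ?q"
        unfolding t(2) e comb_basis(1)[symmetric] by (simp add: gal_comb comb_mult comb_add)
      then have "gal e \<rho> \<otimes> ?q = w \<otimes> ?q"
        using gal_mult[of \<rho> \<iota> e] q w' by (simp add: \<rho>_\<iota> m_comm)
      moreover have "?q \<noteq> \<zero>"
        using q w' by auto
      ultimately show ?thesis
        using q w' by (simp add: m_rcancel)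
    qed
    ultimately show thesis
      by (rule that)
  qed
  have "\<one> \<ominus> w \<noteq> \<zero>"
  proof
    assume "\<one> \<ominus> w = \<zero>"
    then have "w = \<one>"
      using w' by simp
    then have "gal e \<rho> = gal e \<one>"
      by (simp only: e(2) gal_1)
    then show False
      using \<rho>_neq_1 by (simp only: gal_eq_iff \<rho>_closed one_closed)
  qed
  then have unit: "\<one> \<ominus> w \<in> Units K"
    using w' by (simp add: field_Units)
  let ?v = "inv (\<one> \<ominus> w) \<otimes> v"
  have v': "?v \<in> carrier K"
    using unit w(2) by simp
  have "v \<oplus> w \<otimes> ?v = ?v"
  proof -
    have "v = (\<one> \<ominus> w) \<otimes> ?v"
      using unit w(2) w' by (simp flip: m_assoc)
    then have "v \<oplus> w \<otimes> ?v = (\<one> \<ominus> w) \<otimes> ?v \<oplus> w \<otimes> ?v"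
      by simp
    also have "\<dots> = ?v"
      using v' w'(1) by algebra
    finally show ?thesis .
  qed
  then have "aff ?v \<gamma> e \<otimes>\<^bsub>Perm\<^esub> rep (pres_gen rels x) = rep (\<alpha> (pres_gen rels x)) \<otimes>\<^bsub>Perm\<^esub> aff ?v \<gamma> e" for x
  proof (cases x)
    case a
    then show ?thesis
      using \<open>v \<oplus> w \<otimes> ?v = ?v\<close> \<gamma>(1) \<gamma>_nonzero v' w(2) w'
      by (simp add: rep_A w(1) aff_mult flip: e(2)) (simp add: m_comm)
  next
    case b
    then show ?thesis
      using \<gamma>(1) \<gamma>_nonzero v' \<beta>(1) by (simp add: rep_B \<beta>(2) aff_mult a_comm flip: e(1))
  next
    case c
    then show ?thesis
      using \<gamma>(1) \<gamma>_nonzero v' by (simp add: rep_C \<gamma>(2) aff_mult comb_0_1 a_comm)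
  qed
  then show thesis
    using v' \<gamma>(1) \<gamma>_nonzero that by blast
qed

text \<open>
  Commuting with the translation by \<open>1\<close> forces \<open>u = 1\<close>, commuting with the translation by \<open>s\<close> rules out
  the nontrivial field automorphism, and commuting with the scaling by \<open>\<rho> \<noteq> 1\<close> forces \<open>0\<close> to be
  fixed.
\<close>

lemma conjugation_faithful:
  assumes vu: "v \<in> carrier K" "u \<in> carrier K" "u \<noteq> \<zero>"
    and comm: "\<And>x. aff v u e \<otimes>\<^bsub>Perm\<^esub> rep (pres_gen rels x) = rep (pres_gen rels x) \<otimes>\<^bsub>Perm\<^esub> aff v u e"
  shows "aff v u e = \<one>\<^bsub>Perm\<^esub>"
proof -
  have "aff (v \<oplus> u) u e = aff (\<one> \<oplus> v) u e"
    using comm[of abc.c] vu by (simp add: rep_C comb_0_1 aff_mult)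
  from aff_eqD[OF odd_p this] have "v \<oplus> u = v \<oplus> \<one>"
    using vu by (simp add: a_comm)
  then have u: "u = \<one>"
    using vu by simp
  have "aff (v \<oplus> gal e (comb 0 1)) \<one> e = aff (comb 0 1 \<oplus> v) \<one> e"
    using comm[of abc.b] vu by (simp add: rep_B u aff_mult)
  from aff_eqD[OF odd_p this] have "v \<oplus> gal e (comb 0 1) = v \<oplus> comb 0 1"
    using vu by (simp add: a_comm)
  then have "gal e (comb 0 1) = comb 0 1"
    using vu by simp
  then have e: "\<not> e"
    using s_neq_minus_s[OF odd_p] by (auto simp: gal_comb)
  have "aff v \<rho> False = aff (\<rho> \<otimes> v) \<rho> False"
    using comm[of abc.a] vu e by (simp add: rep_A u aff_mult)
  from aff_eqD[OF odd_p this] have "\<one> \<otimes> v = \<rho> \<otimes> v"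
    using vu by simp
  then have "v = \<zero>"
    using \<rho>_neq_1 vu(1) m_rcancel[of v \<one> \<rho>] by auto
  with u e show ?thesis
    by (simp add: aff_one)
qed

lemma automorphism_group:
  "\<exists>\<psi> \<phi>. \<psi> \<in> hom (integer_mod_group 2) (AutoGroup (integer_mod_group (p ^ 2 - 1))) \<and>
    \<phi> \<in> hom (semidirect (integer_mod_group (p ^ 2 - 1)) (integer_mod_group 2) \<psi>)
      (AutoGroup (integer_mod_group p \<times>\<times> integer_mod_group p)) \<and>
    AutoGroup \<Gamma> \<cong> semidirect (integer_mod_group p \<times>\<times> integer_mod_group p)
      (semidirect (integer_mod_group (p ^ 2 - 1)) (integer_mod_group 2) \<psi>) \<phi>"
proof -
  obtain \<psi> \<phi> F where \<psi>: "\<psi> \<in> hom (integer_mod_group 2) (AutoGroup (integer_mod_group (p ^ 2 - 1)))"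
    and \<phi>: "\<phi> \<in> hom (semidirect (integer_mod_group (p ^ 2 - 1)) (integer_mod_group 2) \<psi>)
      (AutoGroup (integer_mod_group p \<times>\<times> integer_mod_group p))"
    and F: "F \<in> hom (semidirect (integer_mod_group p \<times>\<times> integer_mod_group p)
      (semidirect (integer_mod_group (p ^ 2 - 1)) (integer_mod_group 2) \<psi>) \<phi>) Perm"
    and F_inj: "inj_on F (carrier (semidirect (integer_mod_group p \<times>\<times> integer_mod_group p)
      (semidirect (integer_mod_group (p ^ 2 - 1)) (integer_mod_group 2) \<psi>) \<phi>))"
    and F_image: "F ` carrier (semidirect (integer_mod_group p \<times>\<times> integer_mod_group p)
      (semidirect (integer_mod_group (p ^ 2 - 1)) (integer_mod_group 2) \<psi>) \<phi>) =
      {aff v u e | v u e. v \<in> carrier K \<and> u \<in> carrier K \<and> u \<noteq> \<zero>}"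
    by (rule semilinear_affine_group)
  let ?W = "semidirect (integer_mod_group p \<times>\<times> integer_mod_group p)
      (semidirect (integer_mod_group (p ^ 2 - 1)) (integer_mod_group 2) \<psi>) \<phi>"
  have W: "group ?W"
    by (intro group_semidirect[OF _ _ \<phi>] group_semidirect[OF _ _ \<psi>] DirProd_group) simp_all
  have F_form: "\<exists>v u e. F w = aff v u e \<and> v \<in> carrier K \<and> u \<in> carrier K \<and> u \<noteq> \<zero>" if "w \<in> carrier ?W" for w
    using that F_image by blast
  have normal: "\<exists>V\<in>carrier \<Gamma>. F w \<otimes>\<^bsub>Perm\<^esub> rep U = rep V \<otimes>\<^bsub>Perm\<^esub> F w"
    if "U \<in> carrier \<Gamma>" "w \<in> carrier ?W" for U w
    using F_form[OF that(2)] rep_normalised that(1) by auto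
  obtain \<theta> where \<theta>: "\<theta> \<in> hom ?W (AutoGroup \<Gamma>)"
    and conj: "\<And>U w. \<lbrakk>U \<in> carrier \<Gamma>; w \<in> carrier ?W\<rbrakk> \<Longrightarrow>
      F w \<otimes>\<^bsub>Perm\<^esub> rep U = rep (\<theta> w U) \<otimes>\<^bsub>Perm\<^esub> F w"
    using conjugation_action[OF group_presented_group W group_BijGroup rep_hom rep_inj F normal] by blast
  interpret F: group_hom ?W Perm F
    by (intro group_hom.intro group_hom_axioms.intro W F group_BijGroup)
  interpret \<theta>: group_hom ?W "AutoGroup \<Gamma>" \<theta>
    by (intro group_hom.intro group_hom_axioms.intro W \<theta> \<Gamma>.AutoGroup)
  have "inj_on \<theta> (carrier ?W)"
  proof (unfold \<theta>.inj_on_one_iff, intro allI impI)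
    fix w assume w: "w \<in> carrier ?W" and "\<theta> w = \<one>\<^bsub>AutoGroup \<Gamma>\<^esub>"
    then have "F w \<otimes>\<^bsub>Perm\<^esub> rep (pres_gen rels x) = rep (pres_gen rels x) \<otimes>\<^bsub>Perm\<^esub> F w" for x
      using conj[OF pres_gen_closed w] by (simp add: AutoGroup_def BijGroup_def)
    moreover obtain v u e where vu: "F w = aff v u e" "v \<in> carrier K" "u \<in> carrier K" "u \<noteq> \<zero>"
      using F_form[OF w] by blast
    ultimately have "aff v u e = \<one>\<^bsub>Perm\<^esub>"
      by (intro conjugation_faithful vu(2-4)) (simp only: vu(1))
    then have "F w = F \<one>\<^bsub>?W\<^esub>"
      by (simp only: vu(1) F.hom_one)
    then show "w = \<one>\<^bsub>?W\<^esub>"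
      using F_inj w by (meson F.G.one_closed inj_onD)
  qed
  moreover have "\<alpha> \<in> \<theta> ` carrier ?W" if \<alpha>: "\<alpha> \<in> carrier (AutoGroup \<Gamma>)" for \<alpha>
  proof -
    obtain v u e where vu: "v \<in> carrier K" "u \<in> carrier K" "u \<noteq> \<zero>"
      and \<alpha>_conj: "\<And>x. aff v u e \<otimes>\<^bsub>Perm\<^esub> rep (pres_gen rels x) =
        rep (\<alpha> (pres_gen rels x)) \<otimes>\<^bsub>Perm\<^esub> aff v u e"
      by (rule automorphism_is_conjugation[OF \<alpha>]) (rule that)
    have "aff v u e \<in> F ` carrier ?W"
      unfolding F_image using vu by blast
    then obtain w where "aff v u e = F w" and w: "w \<in> carrier ?W"
      by (rule imageE)
    note Fw = \<open>aff v u e = F w\<close>[symmetric]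
    have aut: "\<beta> \<in> hom \<Gamma> \<Gamma>" "\<beta> \<in> extensional (carrier \<Gamma>)" if "\<beta> \<in> carrier (AutoGroup \<Gamma>)" for \<beta>
      using that by (auto simp: AutoGroup_def auto_def Bij_def)
    note \<theta>w = aut[OF \<theta>.hom_closed[OF w]] and \<alpha>' = aut[OF \<alpha>]
    have "\<theta> w (pres_gen rels x) = \<alpha> (pres_gen rels x)" for x
    proof -
      have cl: "\<theta> w (pres_gen rels x) \<in> carrier \<Gamma>" "\<alpha> (pres_gen rels x) \<in> carrier \<Gamma>"
        using \<theta>w \<alpha>' by (auto simp: hom_def)
      have "rep (\<theta> w (pres_gen rels x)) \<otimes>\<^bsub>Perm\<^esub> F w = rep (\<alpha> (pres_gen rels x)) \<otimes>\<^bsub>Perm\<^esub> F w"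
        using conj[OF pres_gen_closed w] \<alpha>_conj by (simp only: Fw)
      then have "rep (\<theta> w (pres_gen rels x)) = rep (\<alpha> (pres_gen rels x))"
        using rep.H.right_cancel[OF F.hom_closed[OF w] rep.hom_closed[OF cl(1)] rep.hom_closed[OF cl(2)]]
        by simp
      then show ?thesis
        using rep_eq_iff cl by simp
    qed
    then have "\<theta> w = \<alpha>"
      using \<theta>w \<alpha>' presented_group_hom_eqI[OF group_presented_group]
      by (intro extensionalityI[where A = "carrier \<Gamma>"]) blast+
    with w show ?thesis
      by blast
  qed
  ultimately have "\<theta> \<in> iso ?W (AutoGroup \<Gamma>)"
    using \<theta> \<theta>.hom_closed by (auto simp: iso_def bij_betw_def)
  then have "AutoGroup \<Gamma> \<cong> ?W"
    using group.iso_sym[OF W] by (auto simp: is_iso_def)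
  with \<psi> \<phi> show ?thesis
    by blast
qed

end

theorem mainTheorem13:
  fixes p :: nat and D m n :: int
    and K :: "('k, 'e) ring_scheme" and sqrtD \<sigma> :: 'k
  assumes "Factorial_Ring.prime p" and "p \<noteq> 3" and "[p = 3] (mod 4)"
    and "\<not> QuadRes (int p) D"
    and "field K" and "order K = p ^ 2"
    and "sqrtD \<in> carrier K" and "sqrtD [^]\<^bsub>K\<^esub> (2::nat) = [D] \<cdot>\<^bsub>K\<^esub> \<one>\<^bsub>K\<^esub>"
    and "\<sigma> \<in> carrier (Multiplicative_Group.mult_of K)" and "generate (Multiplicative_Group.mult_of K) {\<sigma>} = carrier (Multiplicative_Group.mult_of K)"
    and "[m] \<cdot>\<^bsub>K\<^esub> \<one>\<^bsub>K\<^esub> \<oplus>\<^bsub>K\<^esub> ([n] \<cdot>\<^bsub>K\<^esub> \<one>\<^bsub>K\<^esub>) \<otimes>\<^bsub>K\<^esub> sqrtD = \<sigma> [^]\<^bsub>K\<^esub> ((p ^ 2 - 1) div 4)"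
    and "\<not> [n = 0] (mod int p)"
  shows "\<exists>\<psi> \<phi>.
    \<psi> \<in> hom (integer_mod_group 2) (AutoGroup (integer_mod_group (p ^ 2 - 1))) \<and>
    \<phi> \<in> hom (semidirect (integer_mod_group (p ^ 2 - 1)) (integer_mod_group 2) \<psi>)
            (AutoGroup (integer_mod_group p \<times>\<times> integer_mod_group p)) \<and>
    AutoGroup (presented_group (G_rels p D m n)) \<cong>
      semidirect (integer_mod_group p \<times>\<times> integer_mod_group p)
        (semidirect (integer_mod_group (p ^ 2 - 1)) (integer_mod_group 2) \<psi>) \<phi>"
proof -
  have quadratic: "quadratic_field K p D sqrtD"
    using assms by (simp add: quadratic_field_def quadratic_field_axioms_def)
  have "p mod 4 = 3"
    using assms(3) by (simp add: cong_def)
  then have "odd p"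
    by presburger
  with quadratic have primitive: "primitive_quadratic_field K p D sqrtD \<sigma>"
    using assms(9,10) by (simp add: primitive_quadratic_field_def primitive_quadratic_field_axioms_def)
  interpret presentation_over_field K p D sqrtD \<sigma> m n
  proof (intro presentation_over_field.intro primitive presentation_over_field_axioms.intro)
    show "quadratic_field.comb K sqrtD m n = \<sigma> [^]\<^bsub>Multiplicative_Group.mult_of K\<^esub> ((p ^ 2 - 1) div 4)"
      using assms(11) by (simp only: quadratic_field.comb_def[OF quadratic] Multiplicative_Group.nat_pow_mult_of)
    show "\<not> int p dvd n"
      using assms(12) by (simp add: cong_0_iff)
  qed
  show ?thesis
    by (rule automorphism_group)
qed

end
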